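(* For every $\varepsilon>0$ there exists $n_0$ such that for every integer $n\ge n_0$ divisible by $4$ the following holds. If $G$ is a $3$-graph of order $n$ satisfying $$ \delta_2(G)\ge \begin{cases} \frac{n}{4} & \text{when } \frac{n}{4} \text{ is odd,}\\[2pt] \frac{n}{4}+1 & \text{when } \frac{n}{4} \text{ is even,} \end{cases} $$ and $G$ is not $\varepsilon$-extremal, then $G$ is $D$-tileable.
   Context: A $3$-graph is a $3$-uniform hypergraph $G$ with finite vertex set $V(G)$ and edge set $E(G) \subseteq \binom{V(G)}{3}$; its order is $|V(G)|$. $D=K_4^3-2e$ denotes the $3$-graph on $4$ vertices with exactly $2$ edges. For a pair $\{u,v\}$ of vertices, $N(u,v)=\{w: \{u,v,w\}\in E(G)\}$, and $\delta_2(G)=\min\{|N(u,v)| : \{u,v\}\in\binom{V(G)}{2}\}$. A $3$-graph of order $n$ is $D$-tileable if it contains, as (not necessarily induced) subhypergraphs, $\lfloor n/4\rfloor$ vertex-disjoint copies of $D$. For $S\subset V(G)$, $G[S]$ is the subhypergraph induced on $S$; a $3$-graph is $D$-free if it contains no copy of $D$ as a (not necessarily induced) subhypergraph. For $\varepsilon>0$, a $3$-graph $G$ of order $n$ is $\varepsilon$-extremal if there exists $S\subset V(G)$ of size $|S|\ge(1-\varepsilon)\frac{3n}{4}$ for which $G[S]$ is $D$-free. *)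

theory Defs
  imports Complex_Main
begin

datatype 'a hypergraph = Hypergraph (verts: "'a set") (edges: "'a set set")

definition three_graph :: "'a hypergraph \<Rightarrow> bool" where
  "three_graph G \<longleftrightarrow> finite (verts G) \<and> (\<forall>e \<in> edges G. e \<subseteq> verts G \<and> card e = 3)"

abbreviation graph_order :: "'a hypergraph \<Rightarrow> nat" where
  "graph_order G \<equiv> card (verts G)"

definition subhypergraph :: "'a hypergraph \<Rightarrow> 'a hypergraph \<Rightarrow> bool" where
  "subhypergraph H G \<longleftrightarrow> verts H \<subseteq> verts G \<and> edges H \<subseteq> edges G"

definition induced :: "'a hypergraph \<Rightarrow> 'a set \<Rightarrow> 'a hypergraph" where
  "induced G S = Hypergraph S {e \<in> edges G. e \<subseteq> S}"

definition pair_nbhd :: "'a hypergraph \<Rightarrow> 'a \<Rightarrow> 'a \<Rightarrow> 'a set" where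
  "pair_nbhd G u v = {w. {u, v, w} \<in> edges G}"

text \<open>The minimum codegree; meaningful when there are at least two vertices
  (otherwise it is the unspecified minimum of the empty set).\<close>

definition min_codegree :: "'a hypergraph \<Rightarrow> nat" where
  "min_codegree G =
     Min {card (pair_nbhd G u v) | u v. u \<in> verts G \<and> v \<in> verts G \<and> u \<noteq> v}"

text \<open>Any two 3-graphs with 4 vertices and exactly 2 edges are isomorphic (two distinct
  3-subsets of a 4-set always share a pair), so this property determines \<open>D = K\<^sub>4\<^sup>3 - 2e\<close>
  up to isomorphism.\<close>

definition is_D :: "'a hypergraph \<Rightarrow> bool" where
  "is_D H \<longleftrightarrow> three_graph H \<and> card (verts H) = 4 \<and> card (edges H) = 2"

definition D_copy :: "'a hypergraph \<Rightarrow> 'a hypergraph \<Rightarrow> bool" where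
  "D_copy H G \<longleftrightarrow> subhypergraph H G \<and> is_D H"

definition D_free :: "'a hypergraph \<Rightarrow> bool" where
  "D_free G \<longleftrightarrow> \<not> (\<exists>H. D_copy H G)"

definition D_tileable :: "'a hypergraph \<Rightarrow> bool" where
  "D_tileable G \<longleftrightarrow>
     (\<exists>T. finite T \<and> card T = graph_order G div 4 \<and> (\<forall>H \<in> T. D_copy H G) \<and>
          pairwise (\<lambda>H H'. disjnt (verts H) (verts H')) T)"

definition extremal :: "real \<Rightarrow> 'a hypergraph \<Rightarrow> bool" where
  "extremal \<epsilon> G \<longleftrightarrow>
     (\<exists>S \<subseteq> verts G. real (card S) \<ge> (1 - \<epsilon>) * (3 * real (graph_order G) / 4) \<and>
          D_free (induced G S))"

end

theory Submission
  imports Defs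
begin

text \<open>
  A copy of \<open>D\<close> is a pair \<open>{a, b}\<close> together with two of its neighbours; call its vertex set a tile.
  The proof is an absorption argument that exploits how flexible the two neighbours are. It sets aside
  a small set \<open>A\<close> which is tileable and stays tileable after the addition of any boundedly many
  further vertices (their number a multiple of 4), tiles the rest up to boundedly many vertices, and
  lets \<open>A\<close> swallow what is left.

  Tiling almost everything (\<open>almost_tiling\<close>) is the only place where non-extremality enters. Let
  \<open>W\<close> be the set missed by a maximum tiling. It contains no tile, so a pair in \<open>W\<close> has at most one
  neighbour in \<open>W\<close>, hence on average about one neighbour in each tile of the tiling. No tile of the
  tiling has two vertices with many link edges inside \<open>W\<close>, since each of these could be completed
  to a tile by three vertices of \<open>W\<close>. So if \<open>W\<close> is large, almost every tile has exactly one such rich vertex. The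
  remaining vertices of those tiles form a set of nearly \<open>3n/4\<close> vertices; by non-extremality it
  contains a tile \<open>U\<close>. Replacing the at most four tiles that meet \<open>U\<close> by \<open>U\<close> and one tile for each of
  their rich vertices enlarges the tiling, a contradiction.

  For absorption, call \<open>y\<close> and \<open>u\<close> exchangeable if, even after the deletion of a small linear number of
  vertices, some three vertices form a tile with \<open>y\<close> as well as with \<open>u\<close>. If \<open>p \<in> N(y, u)\<close> and
  \<open>y, b, c, u\<close> is a path in the link graph of \<open>p\<close>, then \<open>{p, b, c}\<close> is such a triple. In any graph only
  few edges lie in few 4-cycles (\<open>few_edges_in_few_four_cycles\<close>), and this, applied to all links, shows
  that all but few pairs are exchangeable, and so that all but at most \<open>n/8\<close> vertices are light: they
  are exchangeable with almost everything (\<open>most_vertices_light\<close>). A set \<open>Q\<close> of four light vertices is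
  then absorbed by a tile \<open>U\<close> of partners together with four exchanging triples
  (\<open>absorber_of_light_vertices\<close>): the triples are tiled either with the vertices of \<open>U\<close>, or with
  those of \<open>Q\<close>, which leaves \<open>U\<close> as a tile of its own.

  Absorbers for all \<open>n\<^sup>4\<close> quadruples do not fit into a small set, so arbitrary vertices are first
  traded for vertices of a set \<open>Y\<close> of size \<open>O(log n)\<close>. In a tile \<open>{a, b, c, y}\<close> with
  \<open>c, y \<in> N(a, b)\<close> the vertex \<open>y\<close> can be replaced by any other vertex of \<open>N(a, b)\<close>, and averaging
  produces a pair whose neighbourhood captures a tenth of any prescribed set. Hence \<open>O(log n)\<close> disjoint
  tiles, each with a light vertex \<open>y\<close>, suffice to admit every vertex (\<open>covering_slot_family\<close>). With as
  many such families as there are leftover vertices, each leftover vertex enters a tile of its own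
  family and expels a vertex of \<open>Y\<close>; the expelled vertices are grouped into quadruples, and disjoint
  absorbers are kept for all of the \<open>O(log\<^sup>4 n)\<close> quadruples in \<open>Y\<close> (\<open>absorbing_set\<close>).
\<close>


section \<open>Counting and greedy selection\<close>

lemma double_count:
  assumes "finite A" "finite B"
  shows "(\<Sum>x\<in>A. card {y \<in> B. R x y}) = (\<Sum>y\<in>B. card {x \<in> A. R x y})"
proof -
  have "(\<Sum>x\<in>A. card {y \<in> B. R x y}) = (\<Sum>x\<in>A. \<Sum>y\<in>B. if R x y then 1 else 0)"
    using assms by (simp add: sum.If_cases Int_def conj_commute)
  also have "\<dots> = (\<Sum>y\<in>B. \<Sum>x\<in>A. if R x y then 1 else 0)"
    by (rule sum.swap)
  also have "\<dots> = (\<Sum>y\<in>B. card {x \<in> A. R x y})"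
    using assms by (simp add: sum.If_cases Int_def conj_commute)
  finally show ?thesis .
qed

lemma square_sum_le_card_mult_sum_squares:
  fixes f :: "'b \<Rightarrow> nat"
  assumes "finite A"
  shows "(\<Sum>x\<in>A. f x)\<^sup>2 \<le> card A * (\<Sum>x\<in>A. (f x)\<^sup>2)"
proof -
  have "0 \<le> (\<Sum>x\<in>A. \<Sum>y\<in>A. (real (f x) - real (f y))\<^sup>2)"
    by (intro sum_nonneg) auto
  also have "\<dots> = 2 * (real (card A) * (\<Sum>x\<in>A. (real (f x))\<^sup>2)) - 2 * (\<Sum>x\<in>A. real (f x))\<^sup>2"
    by (simp add: power2_diff sum.distrib sum_subtractf sum_distrib_left[symmetric]
        sum_distrib_right[symmetric] power2_eq_square algebra_simps)
  finally have "(\<Sum>x\<in>A. real (f x))\<^sup>2 \<le> real (card A) * (\<Sum>x\<in>A. (real (f x))\<^sup>2)"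
    by simp
  then have "real ((\<Sum>x\<in>A. f x)\<^sup>2) \<le> real (card A * (\<Sum>x\<in>A. (f x)\<^sup>2))"
    by simp
  then show ?thesis
    by (simp only: of_nat_le_iff)
qed

text \<open>
  An object that can be found outside every set of at most \<open>B\<close> vertices can be found many times over:
  the supports of all earlier choices are simply forbidden to later ones.
\<close>

lemma greedy_disjoint_choice:
  fixes g :: "'b \<Rightarrow> 'a set"
  assumes "finite I" "finite X0" "card I * s + card X0 \<le> B"
    and ex: "\<And>i X. i \<in> I \<Longrightarrow> finite X \<Longrightarrow> card X \<le> B \<Longrightarrow>
      \<exists>A. P i A \<and> finite (g A) \<and> card (g A) \<le> s \<and> g A \<inter> X = {}"
  shows "\<exists>f. (\<forall>i\<in>I. P i (f i) \<and> finite (g (f i)) \<and> card (g (f i)) \<le> s \<and> g (f i) \<inter> X0 = {}) \<and>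
    (\<forall>i\<in>I. \<forall>j\<in>I. i \<noteq> j \<longrightarrow> g (f i) \<inter> g (f j) = {})"
  using assms
proof (induction I rule: finite_induct)
  case empty
  then show ?case by simp
next
  case (insert i I)
  have "card I * s + card X0 \<le> B"
    using insert.hyps insert.prems(2) by simp
  then obtain f where f: "\<forall>i\<in>I. P i (f i) \<and> finite (g (f i)) \<and> card (g (f i)) \<le> s \<and> g (f i) \<inter> X0 = {}"
    "\<forall>i\<in>I. \<forall>j\<in>I. i \<noteq> j \<longrightarrow> g (f i) \<inter> g (f j) = {}"
    using insert.IH insert.prems by (metis insertCI)
  define X where "X = X0 \<union> (\<Union>j\<in>I. g (f j))"
  have "card (\<Union>j\<in>I. g (f j)) \<le> (\<Sum>j\<in>I. card (g (f j)))"
    by (rule card_UN_le) (use insert.hyps in auto)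
  also have "\<dots> \<le> card I * s"
    using sum_bounded_above[of I "\<lambda>j. card (g (f j))" s] f(1) by simp
  finally have "card X \<le> B"
    using card_Un_le[of X0 "\<Union>j\<in>I. g (f j)"] insert.hyps insert.prems(2) by (simp add: X_def)
  moreover have "finite X"
    using insert.hyps insert.prems f(1) by (auto simp: X_def)
  ultimately obtain A where A: "P i A" "finite (g A)" "card (g A) \<le> s" "g A \<inter> X = {}"
    using insert.prems(3) by blast
  show ?case
  proof (intro exI[of _ "f(i := A)"] conjI)
    show "\<forall>j\<in>insert i I. P j ((f(i := A)) j) \<and> finite (g ((f(i := A)) j)) \<and>
        card (g ((f(i := A)) j)) \<le> s \<and> g ((f(i := A)) j) \<inter> X0 = {}"
      using A f(1) by (auto simp: X_def)
    have *: "g A \<inter> g (f j) = {}" if "j \<in> I" for j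
      using A(4) that by (auto simp: X_def)
    show "\<forall>k\<in>insert i I. \<forall>j\<in>insert i I. k \<noteq> j \<longrightarrow>
        g ((f(i := A)) k) \<inter> g ((f(i := A)) j) = {}"
      using f(2) * by (auto simp: Int_commute)
  qed
qed

lemma partition_into_fours:
  assumes "finite S" "4 dvd card S"
  shows "\<exists>Q. finite Q \<and> \<Union>Q = S \<and> (\<forall>q\<in>Q. card q = 4) \<and> pairwise disjnt Q"
  using assms
proof (induction "card S" arbitrary: S rule: less_induct)
  case less
  show ?case
  proof (cases "S = {}")
    case True
    then show ?thesis by (intro exI[of _ "{}"]) simp
  next
    case False
    then have "4 \<le> card S" using less.prems by (simp add: dvd_imp_le card_gt_0_iff)
    then obtain q where q: "q \<subseteq> S" "card q = 4" by (rule obtain_subset_with_card_n)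
    have finq: "finite q" using q(1) less.prems(1) by (rule finite_subset)
    have card: "card (S - q) = card S - 4" using q finq by (simp add: card_Diff_subset)
    then obtain Q where Q: "finite Q" "\<Union>Q = S - q" "\<forall>q\<in>Q. card q = 4" "pairwise disjnt Q"
      using less.hyps[of "S - q"] less.prems \<open>4 \<le> card S\<close> by (auto simp: dvd_diff_nat)
    have "pairwise disjnt (insert q Q)"
      using Q(2,4) by (auto simp: pairwise_insert disjnt_def)
    then show ?thesis
      using Q(1-3) q by (intro exI[of _ "insert q Q"]) auto
  qed
qed

text \<open>
  The covering argument takes \<open>t\<close> steps, each of which leaves at most nine tenths of the vertices
  uncovered; the second inequality bounds the number of vertices of the absorbing set. With
  \<open>t \<approx> 20 ln n\<close> the first condition holds because \<open>(9/10)\<^sup>t \<le> exp (- t/10)\<close>, while the second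
  needs only \<open>O(ln\<^sup>4 n)\<close> vertices, eventually less than any linear function.
\<close>

lemma logarithmic_parameters:
  fixes c :: real
  assumes "0 < c"
  shows "\<exists>n0. \<forall>n\<ge>n0. \<exists>t B. n * 9 ^ t < 10 ^ t \<and>
    4 * t * (K + 1) + 16 * (K * t) ^ 4 + 20 \<le> B \<and> real B \<le> c * real n"
proof -
  define C where "C = 4 * (K + 1) + 16 * K ^ 4 + (20 :: nat)"
  have "20 \<le> C" by (simp add: C_def)
  then have C_pos: "0 < real C" by linarith
  have "((\<lambda>x::real. x ^ 4 / exp x) \<longlongrightarrow> 0) at_top"
    by (rule tendsto_power_div_exp_0)
  then have "eventually (\<lambda>x::real. x ^ 4 / exp x < c / (real C * 21 ^ 4)) at_top"
    using assms C_pos by (intro order_tendstoD) auto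
  then obtain x0 where x0: "\<And>x. x0 \<le> x \<Longrightarrow> x ^ 4 / exp x < c / (real C * 21 ^ 4)"
    by (auto simp: eventually_at_top_linorder)
  define n0 where "n0 = nat \<lceil>exp (max x0 1)\<rceil>"
  show ?thesis
  proof (rule exI[of _ n0], intro allI impI)
    fix n assume "n0 \<le> n"
    then have "exp (max x0 1) \<le> real n" unfolding n0_def by linarith
    moreover from this have n_pos: "0 < real n" using exp_gt_zero less_le_trans by blast
    ultimately have "max x0 1 \<le> ln (real n)" by (simp only: ln_ge_iff)
    then have ln: "x0 \<le> ln (real n)" "1 \<le> ln (real n)" by auto
    define t where "t = nat \<lceil>20 * ln (real n)\<rceil>"
    have t_lower: "20 * ln (real n) \<le> real t" and t_upper: "real t \<le> 21 * ln (real n)"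
      using ln(2) unfolding t_def by linarith+
    have "real n * (9 / 10) ^ t \<le> real n * exp (- (1 / 10)) ^ t"
      using exp_ge_add_one_self[of "- (1 / 10)"] n_pos by (intro mult_left_mono power_mono) auto
    also have "\<dots> = exp (ln (real n)) * exp (- (real t / 10))"
      using n_pos by (simp flip: exp_of_nat_mult)
    also have "\<dots> = exp (ln (real n) - real t / 10)"
      by (simp only: exp_add[symmetric] diff_conv_add_uminus)
    also have "\<dots> < 1" using t_lower ln(2) by simp
    finally have "real n * (9 / 10) ^ t < 1" .
    then have "real n * 9 ^ t < 10 ^ t" by (simp add: power_divide field_simps)
    then have "real (n * 9 ^ t) < real (10 ^ t)" by simp
    then have 1: "n * 9 ^ t < 10 ^ t" by (simp only: of_nat_less_iff)
    have t1: "1 \<le> t" using t_lower ln(2) by linarith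
    have "t \<le> t ^ 4" "1 \<le> t ^ 4" using t1 self_le_power[of t 4] by auto
    then have "4 * t * (K + 1) + 16 * (K * t) ^ 4 + 20 \<le> 4 * t ^ 4 * (K + 1) + 16 * (K * t) ^ 4 + 20 * t ^ 4"
      by (intro add_mono mult_right_mono mult_left_mono) auto
    then have 2: "4 * t * (K + 1) + 16 * (K * t) ^ 4 + 20 \<le> C * t ^ 4"
      by (simp add: C_def power_mult_distrib algebra_simps)
    have "real t ^ 4 \<le> (21 * ln (real n)) ^ 4"
      using t_upper by (rule power_mono) simp
    then have "real C * real t ^ 4 \<le> real C * (21 * ln (real n)) ^ 4"
      by (rule mult_left_mono) simp
    then have "real (C * t ^ 4) \<le> real C * (21 * ln (real n)) ^ 4"
      by (simp only: of_nat_mult of_nat_power)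
    also have "\<dots> = real C * 21 ^ 4 * (ln (real n) ^ 4)" by (simp add: power_mult_distrib)
    also have "\<dots> \<le> c * real n"
    proof -
      have "ln (real n) ^ 4 / exp (ln (real n)) < c / (real C * 21 ^ 4)" using x0[OF ln(1)] .
      then show ?thesis using n_pos C_pos by (simp add: field_simps)
    qed
    finally show "\<exists>t B. n * 9 ^ t < 10 ^ t \<and>
        4 * t * (K + 1) + 16 * (K * t) ^ 4 + 20 \<le> B \<and> real B \<le> c * real n"
      using 1 2 by blast
  qed
qed

section \<open>Edges of a graph that lie in few closed walks of length four\<close>

text \<open>
  A walk \<open>x, b, c, z\<close> of length three is recorded by its inner vertices; if \<open>(x, z)\<close> is an edge, it
  closes to a walk of length four.
\<close>

definition link_walks :: "('a \<times> 'a) set \<Rightarrow> 'a \<Rightarrow> 'a \<Rightarrow> ('a \<times> 'a) set" where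
  "link_walks H x z = {(b, c). (x, b) \<in> H \<and> (b, c) \<in> H \<and> (c, z) \<in> H}"

text \<open>
  Two applications of the Cauchy--Schwarz inequality show that \<open>F\<close> alone contains at least
  \<open>|F|\<^sup>4 / |V|\<^sup>4\<close> closed walks of length four, whereas the hypothesis allows at most \<open>q |F|\<close> of them.
\<close>

lemma few_edges_in_few_four_cycles:
  assumes "finite V" and H: "H \<subseteq> V \<times> V" "sym H"
    and few: "\<And>x z. (x, z) \<in> F \<Longrightarrow> card (link_walks H x z) \<le> q"
    and F: "F \<subseteq> H" "sym F"
  shows "card F ^ 3 \<le> q * card V ^ 4"
proof -
  define f where "f = card F"
  define n where "n = card V"
  define d where "d b = card {x \<in> V. (x, b) \<in> F}" for b
  define cod where "cod x c = card {b \<in> V. (x, b) \<in> F \<and> (b, c) \<in> F}" for x c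
  have FV: "F \<subseteq> V \<times> V" using F(1) H(1) by blast
  have finF: "finite F" using FV \<open>finite V\<close> by (simp add: finite_subset)
  have symF: "(x, y) \<in> F \<longleftrightarrow> (y, x) \<in> F" for x y using F(2) by (auto dest: symD)
  have f_d: "f = (\<Sum>b\<in>V. d b)"
  proof -
    have "F = (\<Union>b\<in>V. (\<lambda>x. (x, b)) ` {x \<in> V. (x, b) \<in> F})" using FV by auto
    then have "f = card (\<Union>b\<in>V. (\<lambda>x. (x, b)) ` {x \<in> V. (x, b) \<in> F})" unfolding f_def by simp
    also have "\<dots> = (\<Sum>b\<in>V. card ((\<lambda>x. (x, b)) ` {x \<in> V. (x, b) \<in> F}))"
      by (rule card_UN_disjoint) (use \<open>finite V\<close> in auto)
    also have "\<dots> = (\<Sum>b\<in>V. d b)"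
      unfolding d_def by (intro sum.cong refl card_image) (auto simp: inj_on_def)
    finally show ?thesis .
  qed
  have sum_cod: "(\<Sum>p\<in>V \<times> V. cod (fst p) (snd p)) = (\<Sum>b\<in>V. (d b)\<^sup>2)"
  proof -
    have "(\<Sum>p\<in>V \<times> V. cod (fst p) (snd p))
        = (\<Sum>p\<in>V \<times> V. card {b \<in> V. (fst p, b) \<in> F \<and> (b, snd p) \<in> F})"
      unfolding cod_def ..
    also have "\<dots> = (\<Sum>b\<in>V. card {p \<in> V \<times> V. (fst p, b) \<in> F \<and> (b, snd p) \<in> F})"
      by (rule double_count) (use \<open>finite V\<close> in auto)
    also have "\<dots> = (\<Sum>b\<in>V. (d b)\<^sup>2)"
    proof (intro sum.cong refl)
      fix b
      have "{p \<in> V \<times> V. (fst p, b) \<in> F \<and> (b, snd p) \<in> F} = {x \<in> V. (x, b) \<in> F} \<times> {x \<in> V. (x, b) \<in> F}"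
        using symF by auto
      then show "card {p \<in> V \<times> V. (fst p, b) \<in> F \<and> (b, snd p) \<in> F} = (d b)\<^sup>2"
        by (simp add: d_def power2_eq_square card_cartesian_product)
    qed
    finally show ?thesis .
  qed
  have sum_cod2: "(\<Sum>p\<in>V \<times> V. (cod (fst p) (snd p))\<^sup>2) \<le> f * q"
  proof -
    have "(\<Sum>p\<in>V \<times> V. (cod (fst p) (snd p))\<^sup>2)
        = (\<Sum>p\<in>V \<times> V. card {r \<in> V \<times> V. (fst p, fst r) \<in> F \<and> (fst r, snd p) \<in> F \<and>
             (fst p, snd r) \<in> F \<and> (snd r, snd p) \<in> F})"
    proof (intro sum.cong refl)
      fix p
      have "{r \<in> V \<times> V. (fst p, fst r) \<in> F \<and> (fst r, snd p) \<in> F \<and>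
             (fst p, snd r) \<in> F \<and> (snd r, snd p) \<in> F}
          = {b \<in> V. (fst p, b) \<in> F \<and> (b, snd p) \<in> F} \<times> {b \<in> V. (fst p, b) \<in> F \<and> (b, snd p) \<in> F}"
        by auto
      then show "(cod (fst p) (snd p))\<^sup>2 = card {r \<in> V \<times> V. (fst p, fst r) \<in> F \<and>
          (fst r, snd p) \<in> F \<and> (fst p, snd r) \<in> F \<and> (snd r, snd p) \<in> F}"
        by (simp add: cod_def power2_eq_square card_cartesian_product)
    qed
    also have "\<dots> = card (SIGMA p:V \<times> V. {r \<in> V \<times> V. (fst p, fst r) \<in> F \<and> (fst r, snd p) \<in> F \<and>
             (fst p, snd r) \<in> F \<and> (snd r, snd p) \<in> F})"
      using \<open>finite V\<close> by simp
    also have "\<dots> \<le> card (SIGMA e:F. link_walks H (fst e) (snd e))"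
    proof (rule card_inj_on_le)
      let ?h = "\<lambda>((x, c), (b, z)). ((x, z), (b, c))"
      show "inj_on ?h (SIGMA p:V \<times> V. {r \<in> V \<times> V. (fst p, fst r) \<in> F \<and> (fst r, snd p) \<in> F \<and>
             (fst p, snd r) \<in> F \<and> (snd r, snd p) \<in> F})"
        by (auto simp: inj_on_def)
      show "?h ` (SIGMA p:V \<times> V. {r \<in> V \<times> V. (fst p, fst r) \<in> F \<and> (fst r, snd p) \<in> F \<and>
             (fst p, snd r) \<in> F \<and> (snd r, snd p) \<in> F}) \<subseteq> (SIGMA e:F. link_walks H (fst e) (snd e))"
        using F(1) symF by (auto simp: link_walks_def)
      have "finite (link_walks H x z)" for x z
        by (rule finite_subset[of _ "V \<times> V"]) (use H(1) \<open>finite V\<close> in \<open>auto simp: link_walks_def\<close>)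
      then show "finite (SIGMA e:F. link_walks H (fst e) (snd e))"
        using finF by auto
    qed
    also have "\<dots> = (\<Sum>e\<in>F. card (link_walks H (fst e) (snd e)))"
    proof -
      have "finite (link_walks H x z)" for x z
        by (rule finite_subset[of _ "V \<times> V"]) (use H(1) \<open>finite V\<close> in \<open>auto simp: link_walks_def\<close>)
      then show ?thesis using finF by simp
    qed
    also have "\<dots> \<le> f * q"
      using sum_bounded_above[of F "\<lambda>e. card (link_walks H (fst e) (snd e))" q] few
      by (auto simp: f_def)
    finally show ?thesis .
  qed
  have "f ^ 4 = (f\<^sup>2)\<^sup>2" by simp
  also have "\<dots> \<le> (n * (\<Sum>b\<in>V. (d b)\<^sup>2))\<^sup>2"
    unfolding f_d n_def using square_sum_le_card_mult_sum_squares[OF \<open>finite V\<close>, of d]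
    by (rule power_mono) simp
  also have "\<dots> = n\<^sup>2 * (\<Sum>p\<in>V \<times> V. cod (fst p) (snd p))\<^sup>2"
    by (simp add: sum_cod power_mult_distrib)
  also have "\<dots> \<le> n\<^sup>2 * (card (V \<times> V) * (\<Sum>p\<in>V \<times> V. (cod (fst p) (snd p))\<^sup>2))"
    using square_sum_le_card_mult_sum_squares[of "V \<times> V" "\<lambda>p. cod (fst p) (snd p)"] \<open>finite V\<close>
    by (intro mult_left_mono) auto
  also have "\<dots> \<le> n\<^sup>2 * (card (V \<times> V) * (f * q))"
    using sum_cod2 by (intro mult_left_mono) auto
  also have "\<dots> = f * (q * n ^ 4)"
    by (simp add: n_def card_cartesian_product power2_eq_square power4_eq_xxxx)
  finally have "f * f ^ 3 \<le> f * (q * n ^ 4)"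
    by (simp add: power4_eq_xxxx power3_eq_cube mult.assoc)
  then show ?thesis
    unfolding f_def n_def by (cases "card F = 0") auto
qed

section \<open>Tiles and tilings of a hypergraph with codegree n/4\<close>

locale codegree_hypergraph =
  fixes G :: "'a hypergraph"
  assumes three_graph: "three_graph G"
    and codegree: "\<And>u v. u \<in> verts G \<Longrightarrow> v \<in> verts G \<Longrightarrow> u \<noteq> v \<Longrightarrow>
      real (card (verts G)) / 4 \<le> real (card (pair_nbhd G u v))"
begin

abbreviation V :: "'a set" where "V \<equiv> verts G"
abbreviation N :: "'a \<Rightarrow> 'a \<Rightarrow> 'a set" where "N \<equiv> pair_nbhd G"
abbreviation n :: nat where "n \<equiv> card V"

lemma finite_V [simp]: "finite V"
  using three_graph by (simp add: three_graph_def)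

lemma nbhdD:
  assumes "w \<in> N u v"
  shows "u \<in> V" "v \<in> V" "w \<in> V" "u \<noteq> v" "w \<noteq> u" "w \<noteq> v"
proof -
  have "{u, v, w} \<subseteq> V" "card {u, v, w} = 3"
    using assms three_graph by (auto simp: pair_nbhd_def three_graph_def)
  then show "u \<in> V" "v \<in> V" "w \<in> V" "u \<noteq> v" "w \<noteq> u" "w \<noteq> v"
    by (auto simp: card_insert_if split: if_splits)
qed

lemma nbhd_subset: "N u v \<subseteq> V"
  using nbhdD by blast

lemma finite_nbhd [simp]: "finite (N u v)"
  using nbhd_subset finite_V finite_subset by metis

text \<open>
  Only the vertex sets of copies of \<open>D\<close> matter for tilings. The distinctness of \<open>a\<close>, \<open>b\<close> from each other
  and from their neighbours comes for free, because edges have three elements.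
\<close>

definition tile :: "'a set \<Rightarrow> bool" where
  "tile T \<longleftrightarrow> (\<exists>a b c d. c \<noteq> d \<and> c \<in> N a b \<and> d \<in> N a b \<and> T = {a, b, c, d})"

lemma tileI: "c \<in> N a b \<Longrightarrow> d \<in> N a b \<Longrightarrow> c \<noteq> d \<Longrightarrow> T = {a, b, c, d} \<Longrightarrow> tile T"
  unfolding tile_def by blast

lemma tileD:
  assumes "tile T"
  shows "T \<subseteq> V" "finite T" "card T = 4"
proof -
  obtain a b c d where *: "c \<noteq> d" "c \<in> N a b" "d \<in> N a b" "T = {a, b, c, d}"
    using assms unfolding tile_def by blast
  show "T \<subseteq> V" "finite T" using * nbhdD by auto
  show "card T = 4" using * nbhdD[OF *(2)] nbhdD[OF *(3)] by (auto simp: card_insert_if)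
qed

lemma tile_nonempty: "tile T \<Longrightarrow> T \<noteq> {}"
  using tileD(3) by fastforce

lemma D_copy_of_tile:
  assumes "tile T"
  obtains H where "D_copy H G" "verts H = T"
proof -
  obtain a b c d where *: "c \<noteq> d" "c \<in> N a b" "d \<in> N a b" "T = {a, b, c, d}"
    using assms unfolding tile_def by blast
  let ?H = "Hypergraph T {{a, b, c}, {a, b, d}}"
  have "{a, b, c} \<noteq> {a, b, d}"
    using * nbhdD[OF *(2)] nbhdD[OF *(3)] by auto
  then have "D_copy ?H G"
    using * nbhdD[OF *(2)] nbhdD[OF *(3)] tileD[OF assms]
    by (auto simp: D_copy_def subhypergraph_def is_D_def three_graph_def pair_nbhd_def card_insert_if)
  then show ?thesis using that by simp
qed

text \<open>Two triples in a 4-set meet in a pair, which serves as the base of the tile.\<close>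

lemma tile_of_D_copy:
  assumes "D_copy H (induced G S)"
  obtains T where "tile T" "T \<subseteq> S"
proof -
  have H: "verts H \<subseteq> S" "edges H \<subseteq> edges G" "\<And>e. e \<in> edges H \<Longrightarrow> e \<subseteq> verts H \<and> card e = 3"
    "finite (verts H)" "card (verts H) = 4" "card (edges H) = 2"
    using assms by (auto simp: D_copy_def subhypergraph_def induced_def is_D_def three_graph_def)
  obtain e f where ef: "edges H = {e, f}" "e \<noteq> f"
    using H(6) by (auto simp: card_2_iff)
  have e: "e \<subseteq> verts H" "card e = 3" "finite e" and f: "f \<subseteq> verts H" "card f = 3" "finite f"
    using H(3)[of e] H(3)[of f] ef H(4) by (auto intro: finite_subset)
  have "card (e \<union> f) \<le> 4"
    using e f H(4,5) card_mono[of "verts H" "e \<union> f"] by simp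
  moreover have "card (e \<union> f) + card (e \<inter> f) = 6"
    using card_Un_Int[OF e(3) f(3)] e f by simp
  moreover have "e \<inter> f \<noteq> e"
    using e f ef card_subset_eq[of f e] by auto
  then have "card (e \<inter> f) < 3"
    using e psubset_card_mono[of e "e \<inter> f"] by auto
  ultimately have "card (e \<inter> f) = 2" by linarith
  then obtain a b where ab: "e \<inter> f = {a, b}" "a \<noteq> b"
    by (auto simp: card_2_iff)
  then have "{a, b} \<subseteq> e" "{a, b} \<subseteq> f" by auto
  then have "card (e - {a, b}) = 1" "card (f - {a, b}) = 1"
    using e f ab(2) by (simp_all add: card_Diff_subset)
  then obtain c d where "e - {a, b} = {c}" "f - {a, b} = {d}"
    by (metis card_1_singletonE)
  then have cd: "e = {a, b, c}" "f = {a, b, d}" using ab by auto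
  have "tile {a, b, c, d}"
    by (rule tileI[of c a b d]) (use cd ef H(2) in \<open>auto simp: pair_nbhd_def\<close>)
  then show ?thesis
    using that[of "{a, b, c, d}"] cd e(1) f(1) H(1) by auto
qed

definition tiling :: "'a set set \<Rightarrow> bool" where
  "tiling M \<longleftrightarrow> finite M \<and> (\<forall>T\<in>M. tile T) \<and> pairwise disjnt M"

definition tileable :: "'a set \<Rightarrow> bool" where
  "tileable S \<longleftrightarrow> (\<exists>M. tiling M \<and> \<Union>M = S)"

lemma tiling_empty: "tiling {}"
  by (simp add: tiling_def)

lemma tiling_subset: "tiling M \<Longrightarrow> M' \<subseteq> M \<Longrightarrow> tiling M'"
  unfolding tiling_def by (auto intro: finite_subset pairwise_mono)

lemma tiling_Un:
  assumes M: "tiling M" and M': "tiling M'" and disj: "\<Union>M \<inter> \<Union>M' = {}"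
  shows "tiling (M \<union> M')"
proof -
  have "disjnt S T" if ST: "S \<in> M \<union> M'" "T \<in> M \<union> M'" "S \<noteq> T" for S T
  proof -
    have "disjnt S T" if "S \<in> M" "T \<in> M"
      using M \<open>S \<noteq> T\<close> that by (auto simp: tiling_def pairwise_def)
    moreover have "disjnt S T" if "S \<in> M'" "T \<in> M'"
      using M' \<open>S \<noteq> T\<close> that by (auto simp: tiling_def pairwise_def)
    moreover have "disjnt S T" if "S \<in> M" "T \<in> M'"
      using disj that by (auto simp: disjnt_def)
    moreover have "disjnt S T" if "S \<in> M'" "T \<in> M"
      using disj that by (auto simp: disjnt_def)
    ultimately show ?thesis using ST by blast
  qed
  then have "pairwise disjnt (M \<union> M')"
    by (simp add: pairwise_def)
  then show ?thesis
    using M M' by (auto simp: tiling_def)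
qed

lemma tiling_card:
  assumes "tiling M"
  shows "card (\<Union>M) = 4 * card M"
proof -
  have "card (\<Union>M) = sum card M"
    using assms tileD by (intro card_Union_disjoint) (auto simp: tiling_def)
  also have "\<dots> = 4 * card M"
    using assms tileD(3) by (simp add: tiling_def)
  finally show ?thesis .
qed

lemma tiling_insert:
  assumes "tile T" "tiling M" "T \<inter> \<Union>M = {}"
  shows "tiling (insert T M)" "card (insert T M) = Suc (card M)"
proof -
  have "tiling {T}" using assms(1) by (simp add: tiling_def)
  from tiling_Un[OF this assms(2)] assms(3) show "tiling (insert T M)" by simp
  have "T \<notin> M" using assms tile_nonempty by blast
  then show "card (insert T M) = Suc (card M)" using assms(2) by (simp add: tiling_def)
qed

lemma tileable_subset: "tileable S \<Longrightarrow> S \<subseteq> V"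
  unfolding tileable_def tiling_def using tileD(1) by blast

lemma tileable_finite: "tileable S \<Longrightarrow> finite S"
  using tileable_subset finite_V finite_subset by metis

lemma tileable_dvd: "tileable S \<Longrightarrow> 4 dvd card S"
  unfolding tileable_def using tiling_card by auto

lemma tileable_tile: "tile T \<Longrightarrow> tileable T"
  unfolding tileable_def by (rule exI[of _ "{T}"]) (simp add: tiling_def)

lemma tileable_empty: "tileable {}"
  unfolding tileable_def using tiling_empty by blast

lemma tileable_Un: "tileable S \<Longrightarrow> tileable S' \<Longrightarrow> S \<inter> S' = {} \<Longrightarrow> tileable (S \<union> S')"
  unfolding tileable_def
proof (elim exE conjE)
  fix M M' assume *: "S \<inter> S' = {}" "tiling M" "\<Union>M = S" "tiling M'" "\<Union>M' = S'"
  then have "tiling (M \<union> M')" by (intro tiling_Un) auto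
  then show "\<exists>M. tiling M \<and> \<Union>M = S \<union> S'" using * by (intro exI[of _ "M \<union> M'"]) auto
qed

lemma tileable_UN:
  assumes "finite I" "\<And>i. i \<in> I \<Longrightarrow> tileable (S i)"
    and "\<And>i j. i \<in> I \<Longrightarrow> j \<in> I \<Longrightarrow> i \<noteq> j \<Longrightarrow> S i \<inter> S j = {}"
  shows "tileable (\<Union>i\<in>I. S i)"
  using assms
proof (induction I rule: finite_induct)
  case empty
  then show ?case by (simp add: tileable_empty)
next
  case (insert i I)
  have "S i \<inter> (\<Union>j\<in>I. S j) = {}"
    using insert.prems(2)[of i] insert.hyps(2) by blast
  then show ?case
    using insert by (auto intro!: tileable_Un)
qed

lemma D_tileable_if_tileable:
  assumes "tileable V"
  shows "D_tileable G"
proof -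
  obtain M where M: "tiling M" "\<Union>M = V"
    using assms unfolding tileable_def by blast
  have "\<forall>T\<in>M. \<exists>H. D_copy H G \<and> verts H = T"
    using M(1) D_copy_of_tile unfolding tiling_def by metis
  then obtain h where h: "\<And>T. T \<in> M \<Longrightarrow> D_copy (h T) G \<and> verts (h T) = T"
    by metis
  have "inj_on h M" using h by (metis inj_onI)
  then have "card (h ` M) = card V div 4"
    using tiling_card[OF M(1)] M(2) by (simp add: card_image)
  moreover have "pairwise (\<lambda>H H'. disjnt (verts H) (verts H')) (h ` M)"
    using M(1) h unfolding tiling_def pairwise_def by auto
  ultimately show ?thesis
    unfolding D_tileable_def using h M(1) by (intro exI[of _ "h ` M"]) (auto simp: tiling_def)
qed

section \<open>Tiling all but boundedly many vertices\<close>

definition link_on :: "'a set \<Rightarrow> 'a \<Rightarrow> ('a \<times> 'a) set" where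
  "link_on W v = {(p, q) \<in> W \<times> W. v \<in> N p q}"

text \<open>
  The constant leaves room to complete up to four rich vertices to pairwise disjoint tiles, see
  \<open>path_in_dense_link\<close> with at most 11 forbidden vertices.
\<close>

definition rich :: "'a set \<Rightarrow> 'a \<Rightarrow> bool" where
  "rich W v \<longleftrightarrow> 30 * card W < card (link_on W v)"

text \<open>
  At most \<open>2 |Z| |W|\<close> ordered link edges meet \<open>Z\<close>. If no two of the others shared a vertex, they would
  form a matching, with at most \<open>|W|\<close> ordered edges. A path with two edges in the link of \<open>v\<close> is exactly
  what completes \<open>v\<close> to a tile.
\<close>

lemma path_in_dense_link:
  assumes "finite W" "finite Z" and dense: "(2 * card Z + 1) * card W < card (link_on W v)"
  shows "\<exists>p\<in>W - Z. \<exists>q\<in>W - Z. \<exists>r\<in>W - Z. q \<noteq> r \<and> v \<in> N p q \<and> v \<in> N p r"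
proof (rule ccontr)
  assume contra: "\<not> ?thesis"
  have unique: "q = r"
    if "p \<in> W - Z" "q \<in> W - Z" "r \<in> W - Z" "v \<in> N p q" "v \<in> N p r" for p q r
    using contra that by auto
  define L where "L = {(p, q) \<in> (W - Z) \<times> (W - Z). v \<in> N p q}"
  have "inj_on fst L"
    using unique by (auto simp: L_def inj_on_def)
  then have L: "card L \<le> card W"
    by (rule card_inj_on_le) (use assms(1) in \<open>auto simp: L_def\<close>)
  have "link_on W v \<subseteq> Z \<times> W \<union> W \<times> Z \<union> L"
    by (auto simp: link_on_def L_def)
  moreover have "finite (Z \<times> W \<union> W \<times> Z \<union> L)"
    using assms(1,2) finite_subset[of L "W \<times> W"] by (auto simp: L_def)
  ultimately have "card (link_on W v) \<le> card (Z \<times> W \<union> W \<times> Z \<union> L)"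
    by (rule card_mono[rotated])
  also have "\<dots> \<le> card (Z \<times> W) + card (W \<times> Z) + card L"
    using card_Un_le[of "Z \<times> W \<union> W \<times> Z" L] card_Un_le[of "Z \<times> W" "W \<times> Z"] by linarith
  also have "\<dots> \<le> (2 * card Z + 1) * card W"
    using L by (simp add: card_cartesian_product algebra_simps)
  finally show False using dense by simp
qed

text \<open>
  Each rich vertex consumes three vertices of \<open>W\<close>; these are added to the forbidden set \<open>Z\<close> before the
  next one is served.
\<close>

lemma tiling_of_rich_vertices:
  assumes "finite W" "finite A" "A \<inter> W = {}" "\<And>v. v \<in> A \<Longrightarrow> rich W v"
    and "finite Z" "card Z + 3 * card A \<le> 14"
  shows "\<exists>P. tiling P \<and> card P = card A \<and> \<Union>P \<subseteq> A \<union> (W - Z)"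
  using assms(2-)
proof (induction A arbitrary: Z rule: finite_induct)
  case empty
  then show ?case by (intro exI[of _ "{}"]) (simp add: tiling_empty)
next
  case (insert v A)
  have "card Z \<le> 11"
    using insert.hyps insert.prems(4) by simp
  then have "(2 * card Z + 1) * card W \<le> 30 * card W"
    by (intro mult_right_mono) auto
  also have "\<dots> < card (link_on W v)"
    using insert.prems(2)[of v] by (simp add: rich_def)
  finally obtain p q r where pqr: "p \<in> W - Z" "q \<in> W - Z" "r \<in> W - Z" "q \<noteq> r" "v \<in> N p q" "v \<in> N p r"
    using path_in_dense_link[OF \<open>finite W\<close> \<open>finite Z\<close>] by blast
  define Z' where "Z' = Z \<union> {p, q, r}"
  have "card Z' \<le> card Z + 3"
    unfolding Z'_def by (rule order_trans[OF card_Un_le]) (simp add: card_insert_if)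
  then have "card Z' + 3 * card A \<le> 14"
    using insert.hyps insert.prems(4) by simp
  moreover have "finite Z'" using insert.prems(3) by (simp add: Z'_def)
  ultimately obtain P where P: "tiling P" "card P = card A" "\<Union>P \<subseteq> A \<union> (W - Z')"
    using insert.IH[of Z'] insert.prems(1,2) by auto
  have "tile {p, v, q, r}"
    by (rule tileI[of q p v r]) (use pqr in \<open>auto simp: pair_nbhd_def insert_commute\<close>)
  moreover have "{p, v, q, r} \<inter> \<Union>P = {}"
    using P(3) pqr insert.hyps(2) insert.prems(1) by (auto simp: Z'_def)
  ultimately have "tiling (insert {p, v, q, r} P)" "card (insert {p, v, q, r} P) = Suc (card P)"
    using tiling_insert P(1) by auto
  moreover have "\<Union>(insert {p, v, q, r} P) \<subseteq> insert v A \<union> (W - Z)"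
    using P(3) pqr by (auto simp: Z'_def)
  ultimately show ?case
    using P(2) insert.hyps by (intro exI[of _ "insert {p, v, q, r} P"]) simp
qed

lemma tiling_exchange:
  assumes M: "tiling M" and R: "R \<subseteq> M" and P: "tiling P" "\<Union>P \<inter> \<Union>M \<subseteq> \<Union>R"
  shows "tiling ((M - R) \<union> P)" "card ((M - R) \<union> P) + card R = card M + card P"
proof -
  have disj: "T \<inter> T' = {}" if "T \<in> M - R" "T' \<in> P" for T T'
  proof -
    have "x \<notin> T'" if "x \<in> T" for x
    proof
      assume "x \<in> T'"
      then have "x \<in> \<Union>P \<inter> \<Union>M"
        using \<open>T \<in> M - R\<close> \<open>T' \<in> P\<close> \<open>x \<in> T\<close> by auto
      then obtain T'' where "T'' \<in> R" "x \<in> T''" using P(2) by auto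
      moreover have "T \<inter> T'' = {}"
        using M R \<open>T \<in> M - R\<close> \<open>T'' \<in> R\<close> unfolding tiling_def pairwise_def disjnt_def
        by (metis DiffD1 DiffD2 subsetD)
      ultimately show False using \<open>x \<in> T\<close> by auto
    qed
    then show ?thesis by auto
  qed
  have "tiling (M - R)" using M by (rule tiling_subset) auto
  then show "tiling ((M - R) \<union> P)"
    using P(1) disj by (intro tiling_Un) auto
  have "(M - R) \<inter> P = {}"
  proof -
    have "T \<notin> P" if "T \<in> M - R" for T
      using disj[OF that, of T] that M tile_nonempty[of T] by (auto simp: tiling_def)
    then show ?thesis by auto
  qed
  moreover have "finite M" "finite P" using M P(1) by (auto simp: tiling_def)
  ultimately show "card ((M - R) \<union> P) + card R = card M + card P"
    using R card_mono[of M R]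
    by (simp add: card_Un_disjoint card_Diff_subset finite_subset)
qed

text \<open>
  The set \<open>W\<close> left over by a maximum tiling of \<open>V - X\<close> is bounded in terms of \<open>\<gamma>\<close> alone. Counting
  pairs of \<open>W\<close> against their neighbours in the tiling shows that otherwise all but about
  \<open>3 \<gamma> n\<close> of the at most \<open>n/4\<close> tiles have a rich vertex. Deleting the rich vertices from these tiles
  leaves a set \<open>S\<close> that is too large to be free of tiles, and a tile inside \<open>S\<close> yields a larger tiling.
\<close>

lemma almost_tiling:
  fixes \<gamma> \<epsilon> :: real and K :: nat
  assumes \<gamma>: "0 < \<gamma>" "12 * \<gamma> \<le> \<epsilon>" "1 \<le> \<gamma> * n" and K: "30 / \<gamma> + 1 \<le> K"
    and X: "X \<subseteq> V" "card X \<le> \<gamma> * n"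
    and nonextremal: "\<And>S. S \<subseteq> V \<Longrightarrow> (1 - \<epsilon>) * (3 * n / 4) \<le> card S \<Longrightarrow> \<exists>T\<subseteq>S. tile T"
  shows "\<exists>S\<subseteq>V - X. tileable S \<and> card (V - X - S) \<le> K"
proof -
  have "\<exists>M. (tiling M \<and> \<Union>M \<subseteq> V - X) \<and>
      (\<forall>M'. tiling M' \<and> \<Union>M' \<subseteq> V - X \<longrightarrow> card M' \<le> card M)"
  proof (rule ex_has_greatest_nat[where b = "Suc n"])
    show "tiling {} \<and> \<Union>{} \<subseteq> V - X" by (simp add: tiling_empty)
    show "\<forall>M. tiling M \<and> \<Union>M \<subseteq> V - X \<longrightarrow> card M < Suc n"
    proof (intro allI impI)
      fix M assume "tiling M \<and> \<Union>M \<subseteq> V - X"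
      then have "4 * card M = card (\<Union>M)" "card (\<Union>M) \<le> n"
        using tiling_card[of M] card_mono[OF finite_V, of "\<Union>M"] by auto
      then show "card M < Suc n" by linarith
    qed
  qed
  then obtain M where M: "tiling M" "\<Union>M \<subseteq> V - X"
    and maximal: "\<And>M'. tiling M' \<Longrightarrow> \<Union>M' \<subseteq> V - X \<Longrightarrow> card M' \<le> card M"
    by blast
  have finM: "finite M" and disjM: "pairwise disjnt M" and tileM: "\<And>T. T \<in> M \<Longrightarrow> tile T"
    using M(1) by (auto simp: tiling_def)
  define W where "W = V - X - \<Union>M"
  define w where "w = card W"
  have finW: "finite W" by (simp add: W_def)
  have no_gain: "card P \<le> card R" if "R \<subseteq> M" "tiling P" "\<Union>P \<subseteq> W \<union> \<Union>R" for R P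
  proof -
    have "\<Union>P \<inter> \<Union>M \<subseteq> \<Union>R" using that(3) by (auto simp: W_def)
    from tiling_exchange[OF M(1) that(1,2) this]
    have "tiling ((M - R) \<union> P)" "card ((M - R) \<union> P) + card R = card M + card P" by auto
    moreover have "\<Union>((M - R) \<union> P) \<subseteq> V - X"
    proof -
      have "\<Union>R \<subseteq> \<Union>M" using that(1) by (rule Union_mono)
      moreover have "W \<subseteq> V - X" by (auto simp: W_def)
      ultimately have "\<Union>P \<subseteq> V - X" using M(2) that(3) by (meson Un_least order_trans)
      moreover have "\<Union>(M - R) \<subseteq> V - X" using M(2) by (meson Diff_subset Union_mono order_trans)
      ultimately show ?thesis by simp
    qed
    ultimately show ?thesis using maximal[of "(M - R) \<union> P"] by linarith
  qed
  have "w \<le> K"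
  proof (rule ccontr)
    assume "\<not> w \<le> K"
    then have w_large: "30 / \<gamma> \<le> real w - 1" using K by linarith
    then have w1: "1 < real w" using \<gamma>(1) by (smt (verit) divide_pos_pos)

    \<comment> \<open>Two common neighbours in \<open>W\<close> would give a tile inside \<open>W\<close>, exchanged for nothing.\<close>
    have codegree_in_W: "card (N p q \<inter> W) \<le> 1" if "p \<in> W" "q \<in> W" for p q
    proof (rule ccontr)
      assume "\<not> card (N p q \<inter> W) \<le> 1"
      then obtain c d where cd: "c \<in> N p q \<inter> W" "d \<in> N p q \<inter> W" "c \<noteq> d"
        using card_le_Suc0_iff_eq[of "N p q \<inter> W"] finW by auto
      then have "tile {p, q, c, d}" by (intro tileI[of c p q d]) auto
      from tiling_insert[OF this tiling_empty] have "card {{p, q, c, d}} \<le> card ({} :: 'a set set)"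
        using cd that by (intro no_gain) auto
      then show False by simp
    qed

    \<comment> \<open>Two rich vertices of \<open>T\<close> could be completed to two tiles that replace \<open>T\<close>.\<close>
    have one_rich: "v = v'" if "T \<in> M" "v \<in> T" "v' \<in> T" "rich W v" "rich W v'" for T v v'
    proof (rule ccontr)
      assume "v \<noteq> v'"
      moreover have "{v, v'} \<inter> W = {}" using that by (auto simp: W_def)
      ultimately have "\<exists>P. tiling P \<and> card P = card {v, v'} \<and> \<Union>P \<subseteq> {v, v'} \<union> (W - {})"
        using that finW by (intro tiling_of_rich_vertices) auto
      then obtain P where "tiling P" "card P = 2" "\<Union>P \<subseteq> {v, v'} \<union> W"
        using \<open>v \<noteq> v'\<close> by auto
      then show False using no_gain[of "{T}" P] that by auto
    qed

    define Rich where "Rich = {T \<in> M. \<exists>v\<in>T. rich W v}"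
    define E2 where "E2 = {(p, q) \<in> W \<times> W. p \<noteq> q}"
    have finE2: "finite E2" using finW by (auto simp: E2_def intro: finite_subset[of _ "W \<times> W"])
    have cardE2: "real (card E2) = real w * (real w - 1)"
    proof -
      have "E2 = W \<times> W - (\<lambda>p. (p, p)) ` W" by (auto simp: E2_def)
      then have "card E2 = card (W \<times> W) - card ((\<lambda>p. (p, p)) ` W)"
        using finW by (simp add: card_Diff_subset image_subset_iff)
      also have "\<dots> = w * w - w"
        by (simp add: w_def card_cartesian_product card_image inj_on_def)
      finally show ?thesis
        by (cases w) (auto simp: algebra_simps)
    qed
    have link_E2: "link_on W v \<subseteq> E2" for v
      using nbhdD(4) by (auto simp: link_on_def E2_def)
    \<comment> \<open>A tile contributes one full link at most, plus a linear error from its other vertices.\<close>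
    have upper_tile: "(\<Sum>v\<in>T. card (link_on W v)) \<le> (if T \<in> Rich then card E2 else 0) + 120 * w"
      if T: "T \<in> M" for T
    proof (cases "T \<in> Rich")
      case False
      then have "card (link_on W v) \<le> 30 * w" if "v \<in> T" for v
        using T that by (auto simp: Rich_def rich_def w_def not_less)
      then have "(\<Sum>v\<in>T. card (link_on W v)) \<le> card T * (30 * w)"
        using sum_bounded_above[of T "\<lambda>v. card (link_on W v)" "30 * w"] by simp
      then show ?thesis using False tileD[OF tileM[OF T]] by simp
    next
      case True
      then obtain a where a: "a \<in> T" "rich W a" by (auto simp: Rich_def)
      have "card (link_on W v) \<le> 30 * w" if "v \<in> T - {a}" for v
      proof -
        have "\<not> rich W v" using one_rich[OF T, of a v] a that by auto
        then show ?thesis by (simp add: rich_def w_def)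
      qed
      then have "(\<Sum>v\<in>T - {a}. card (link_on W v)) \<le> card (T - {a}) * (30 * w)"
        using sum_bounded_above[of "T - {a}" "\<lambda>v. card (link_on W v)" "30 * w"] by simp
      moreover have "card (T - {a}) = 3" using tileD[OF tileM[OF T]] a by simp
      moreover have "card (link_on W a) \<le> card E2"
        using link_E2 finE2 by (rule card_mono[rotated])
      moreover have "(\<Sum>v\<in>T. card (link_on W v)) = card (link_on W a) + (\<Sum>v\<in>T - {a}. card (link_on W v))"
        using tileD(2)[OF tileM[OF T]] a(1) by (rule sum.remove)
      ultimately show ?thesis using True by simp
    qed
    have "(\<Sum>v\<in>\<Union>M. card (link_on W v)) = (\<Sum>T\<in>M. \<Sum>v\<in>T. card (link_on W v))"
      using tileD(2)[OF tileM] disjM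
      by (subst sum.Union_disjoint) (auto simp: pairwise_def disjnt_def)
    also have "\<dots> \<le> (\<Sum>T\<in>M. (if T \<in> Rich then card E2 else 0) + 120 * w)"
      by (rule sum_mono) (rule upper_tile)
    also have "\<dots> = card Rich * card E2 + 120 * w * card M"
    proof -
      have "M \<inter> {T. T \<in> Rich} = Rich" by (auto simp: Rich_def)
      then show ?thesis using finM by (simp add: sum.distrib sum.If_cases)
    qed
    also have "\<dots> \<le> card Rich * card E2 + 30 * w * n"
    proof -
      have "4 * card M \<le> n"
        using tiling_card[OF M(1)] card_mono[OF finite_V, of "\<Union>M"] M(2) by auto
      then have "30 * w * (4 * card M) \<le> 30 * w * n" by (rule mult_left_mono) simp
      then show ?thesis by simp
    qed
    finally have upper: "(\<Sum>v\<in>\<Union>M. card (link_on W v)) \<le> card Rich * card E2 + 30 * w * n" .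

    \<comment> \<open>Of the \<open>n/4\<close> neighbours of a pair in \<open>W\<close>, only \<open>\<gamma> n\<close> can lie in \<open>X\<close> and one in \<open>W\<close>.\<close>
    have "real (card E2) * (n / 4 - \<gamma> * n - 1)
        \<le> (\<Sum>p\<in>E2. real (card {v \<in> \<Union>M. v \<in> N (fst p) (snd p)}))"
    proof -
      have "n / 4 - \<gamma> * n - 1 \<le> real (card {v \<in> \<Union>M. v \<in> N (fst p) (snd p)})" if pE2: "p \<in> E2" for p
      proof -
        obtain x y where p: "p = (x, y)" "x \<in> W" "y \<in> W" "x \<noteq> y" using pE2 by (auto simp: E2_def)
        have "N x y \<subseteq> X \<union> (N x y \<inter> W) \<union> {v \<in> \<Union>M. v \<in> N x y}"
          using nbhd_subset[of x y] by (auto simp: W_def)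
        then have "card (N x y) \<le> card (X \<union> (N x y \<inter> W) \<union> {v \<in> \<Union>M. v \<in> N x y})"
          using X(1) finite_subset[OF X(1)] by (intro card_mono) auto
        also have "\<dots> \<le> card X + card (N x y \<inter> W) + card {v \<in> \<Union>M. v \<in> N x y}"
          using card_Un_le[of "X \<union> (N x y \<inter> W)" "{v \<in> \<Union>M. v \<in> N x y}"] card_Un_le[of X "N x y \<inter> W"]
          by linarith
        finally have "real (card (N x y)) \<le> \<gamma> * n + 1 + card {v \<in> \<Union>M. v \<in> N x y}"
          using X(2) codegree_in_W[OF p(2,3)] by linarith
        moreover have "n / 4 \<le> real (card (N x y))"
          using codegree[of x y] p by (auto simp: W_def)
        ultimately show ?thesis using p by simp
      qed
      then show ?thesis
        using sum_bounded_below[of E2 "n / 4 - \<gamma> * n - 1"] by fastforce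
    qed
    also have "\<dots> \<le> (\<Sum>p\<in>W \<times> W. real (card {v \<in> \<Union>M. v \<in> N (fst p) (snd p)}))"
      using finW by (intro sum_mono2) (auto simp: E2_def)
    also have "\<dots> = real (\<Sum>v\<in>\<Union>M. card {p \<in> W \<times> W. v \<in> N (fst p) (snd p)})"
      using double_count[of "W \<times> W" "\<Union>M" "\<lambda>p v. v \<in> N (fst p) (snd p)"] finW
        finite_subset[OF M(2)] by (simp flip: of_nat_sum)
    also have "\<dots> = real (\<Sum>v\<in>\<Union>M. card (link_on W v))"
    proof -
      have "link_on W v = {p \<in> W \<times> W. v \<in> N (fst p) (snd p)}" for v
        by (auto simp: link_on_def)
      then show ?thesis by simp
    qed
    also have "\<dots> \<le> real (card Rich * card E2 + 30 * w * n)"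
      using upper by (simp only: of_nat_le_iff)
    finally have "real w * ((real w - 1) * (n / 4 - \<gamma> * n - 1))
        \<le> real w * (card Rich * (real w - 1) + 30 * n)"
      by (simp add: cardE2 algebra_simps)
    then have "(real w - 1) * (n / 4 - \<gamma> * n - 1) \<le> card Rich * (real w - 1) + 30 * n"
      using w1 by simp
    moreover have "30 * real n \<le> (real w - 1) * (\<gamma> * n)"
    proof -
      have "30 \<le> (real w - 1) * \<gamma>" using w_large \<gamma>(1) by (simp add: field_simps)
      then have "30 * real n \<le> (real w - 1) * \<gamma> * real n" by (rule mult_right_mono) simp
      then show ?thesis by (simp add: mult.assoc)
    qed
    ultimately have "(real w - 1) * (n / 4 - \<gamma> * n - 1) \<le> (real w - 1) * (card Rich + \<gamma> * n)"
      by (simp add: algebra_simps)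
    then have "n / 4 - \<gamma> * n - 1 \<le> card Rich + \<gamma> * n"
      using w1 by simp
    then have many_rich: "n / 4 - 3 * (\<gamma> * n) \<le> card Rich" using \<gamma>(3) by linarith

    have "\<forall>T\<in>Rich. \<exists>v. v \<in> T \<and> rich W v" by (auto simp: Rich_def)
    then obtain a where a: "\<And>T. T \<in> Rich \<Longrightarrow> a T \<in> T \<and> rich W (a T)" by metis
    have RichM: "Rich \<subseteq> M" by (auto simp: Rich_def)
    have same: "T = T'" if "T \<in> M" "T' \<in> M" "x \<in> T" "x \<in> T'" for T T' x
      using disjM that by (auto simp: pairwise_def disjnt_def)
    define S where "S = (\<Union>T\<in>Rich. T - {a T})"
    have "card S = (\<Sum>T\<in>Rich. card (T - {a T}))"
      unfolding S_def
    proof (rule card_UN_disjoint)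
      show "finite Rich" using RichM finM by (rule finite_subset)
      show "\<forall>T\<in>Rich. finite (T - {a T})" using RichM tileM tileD(2) by blast
      show "\<forall>T\<in>Rich. \<forall>T'\<in>Rich. T \<noteq> T' \<longrightarrow> (T - {a T}) \<inter> (T' - {a T'}) = {}"
        using same RichM by blast
    qed
    also have "\<dots> = (\<Sum>T\<in>Rich. 3)"
    proof (rule sum.cong)
      fix T assume "T \<in> Rich"
      then show "card (T - {a T}) = 3"
        using a[of T] RichM tileM tileD[of T] by auto
    qed simp
    finally have cardS: "card S = 3 * card Rich" by simp
    have "(1 - \<epsilon>) * (3 * n / 4) \<le> card S"
    proof -
      have "\<epsilon> * (3 * n / 4) \<ge> (12 * \<gamma>) * (3 * n / 4)"
        using \<gamma>(2) by (intro mult_right_mono) auto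
      then show ?thesis using many_rich cardS by (simp add: algebra_simps)
    qed
    moreover have SM: "S \<subseteq> \<Union>M" using RichM by (auto simp: S_def)
    then have "S \<subseteq> V" using M(2) by blast
    ultimately obtain U where U: "tile U" "U \<subseteq> S" using nonextremal by blast

    \<comment> \<open>The tiles that meet \<open>U\<close> give way to \<open>U\<close> and one new tile through each of their rich vertices,
      which \<open>U\<close> avoids. This is a gain of one.\<close>
    define R where "R = {T \<in> Rich. T \<inter> U \<noteq> {}}"
    have RM: "R \<subseteq> M" using RichM by (auto simp: R_def)
    have finR: "finite R" using RM finM by (rule finite_subset)
    have "\<forall>T\<in>R. \<exists>x. x \<in> T \<inter> U" by (auto simp: R_def)
    then obtain x where x: "\<And>T. T \<in> R \<Longrightarrow> x T \<in> T \<inter> U" by metis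
    have "inj_on x R" using x same RM by (intro inj_onI) (metis IntD1 subsetD)
    then have cardR: "card R \<le> 4"
      using card_inj_on_le[of x R U] x tileD[OF U(1)] by auto
    have "inj_on a R" using a same RM by (intro inj_onI) (metis (no_types, lifting) R_def mem_Collect_eq subsetD)
    then have cardA: "card (a ` R) = card R" by (rule card_image)
    have aW: "a ` R \<inter> W = {}" using a RM by (auto simp: R_def W_def)
    have "\<exists>P. tiling P \<and> card P = card (a ` R) \<and> \<Union>P \<subseteq> a ` R \<union> (W - {})"
      using finW finR aW a cardR cardA
      by (intro tiling_of_rich_vertices) (auto simp: R_def)
    then obtain P where P: "tiling P" "card P = card R" "\<Union>P \<subseteq> a ` R \<union> W"
      using cardA by auto
    have "U \<inter> W = {}" using U(2) SM by (auto simp: W_def)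
    moreover have "U \<inter> a ` R = {}"
    proof -
      have False if TR: "T \<in> R" "a T \<in> U" for T
      proof -
        obtain T' where T': "T' \<in> Rich" "a T \<in> T'" "a T \<noteq> a T'"
          using TR(2) U(2) by (auto simp: S_def)
        have "T \<in> Rich" using TR(1) by (simp add: R_def)
        then have "T = T'" using same[of T T' "a T"] a T' RichM by blast
        then show False using T'(3) by simp
      qed
      then show ?thesis by blast
    qed
    ultimately have "U \<inter> \<Union>P = {}" using P(3) by blast
    from tiling_insert[OF U(1) P(1) this]
    have "tiling (insert U P)" "card (insert U P) = Suc (card R)" using P(2) by auto
    moreover have "U \<subseteq> \<Union>R" using U(2) by (auto simp: S_def R_def)
    moreover have "a ` R \<subseteq> \<Union>R" using a by (auto simp: R_def)
    moreover have "\<Union>P \<subseteq> W \<union> \<Union>R"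
      using P(3) \<open>a ` R \<subseteq> \<Union>R\<close> by blast
    ultimately show False
      using no_gain[OF RM, of "insert U P"] by auto
  qed
  moreover have "tileable (\<Union>M)" using M(1) by (auto simp: tileable_def)
  ultimately show ?thesis
    using M(2) by (intro exI[of _ "\<Union>M"]) (auto simp: W_def w_def)
qed

section \<open>Exchangeable vertices\<close>

text \<open>
  Asking for a triple outside every small set, rather than for many triples, is what a greedy choice
  of disjoint triples needs.
\<close>

definition exchangeable :: "nat \<Rightarrow> 'a \<Rightarrow> 'a \<Rightarrow> bool" where
  "exchangeable B y u \<longleftrightarrow> (\<forall>X. finite X \<and> card X \<le> B \<longrightarrow>
     (\<exists>T. T \<inter> X = {} \<and> T \<inter> {y, u} = {} \<and> tile (insert y T) \<and> tile (insert u T)))"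

definition blocked :: "nat \<Rightarrow> 'a \<Rightarrow> 'a set" where
  "blocked B y = {u \<in> V. u \<noteq> y \<and> \<not> exchangeable B y u}"

text \<open>
  The blocked sets of four light vertices together occupy at most \<open>n/8\<close> vertices, half of the guaranteed
  codegree, so that a tile can still be found outside them.
\<close>

definition light :: "nat \<Rightarrow> 'a \<Rightarrow> bool" where
  "light B y \<longleftrightarrow> y \<in> V \<and> 32 * card (blocked B y) \<le> n"

definition link :: "'a \<Rightarrow> ('a \<times> 'a) set" where
  "link p = {(x, z). z \<in> N p x}"

definition sparse_link :: "nat \<Rightarrow> 'a \<Rightarrow> ('a \<times> 'a) set" where
  "sparse_link B p = {(x, z) \<in> link p. card (link_walks (link p) x z) \<le> 2 * (B + 1) * n}"

lemma link_subset: "link p \<subseteq> V \<times> V"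
  using nbhdD by (auto simp: link_def)

lemma sym_link: "sym (link p)"
  by (auto simp: link_def sym_def pair_nbhd_def insert_commute)

lemma sym_sparse_link: "sym (sparse_link B p)"
proof (rule symI)
  fix x z assume *: "(x, z) \<in> sparse_link B p"
  have "link_walks (link p) z x = (link_walks (link p) x z)\<inverse>"
    by (auto simp: link_walks_def dest: symD[OF sym_link])
  then have "card (link_walks (link p) z x) = card (link_walks (link p) x z)"
    by simp
  then show "(z, x) \<in> sparse_link B p"
    using * symD[OF sym_link] by (auto simp: sparse_link_def)
qed

text \<open>
  The cubes in \<open>few_edges_in_few_four_cycles\<close> turn the density \<open>2\<^sup>-\<^sup>3\<^sup>3\<close> of walks through a sparse edge
  into the density \<open>2\<^sup>-\<^sup>1\<^sup>1\<close> of sparse edges, which is what the count in \<open>most_vertices_light\<close> requires;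
  this is the origin of the number \<open>2\<^sup>3\<^sup>5\<close>.
\<close>

lemma card_sparse_link:
  assumes "2 ^ 35 * (B + 1) \<le> 2 * n"
  shows "2 ^ 11 * card (sparse_link B p) \<le> n\<^sup>2"
proof -
  let ?f = "card (sparse_link B p)"
  have "?f ^ 3 \<le> (2 * (B + 1) * n) * n ^ 4"
    by (rule few_edges_in_few_four_cycles[OF finite_V link_subset[of p] sym_link _ _ sym_sparse_link])
      (auto simp: sparse_link_def)
  have "(2 ^ 11 * ?f) ^ Suc 2 = 2 ^ 33 * ?f ^ 3"
    by (simp add: power_mult_distrib numeral_3_eq_3)
  also have "\<dots> \<le> 2 ^ 33 * ((2 * (B + 1) * n) * n ^ 4)"
    using \<open>?f ^ 3 \<le> _\<close> by (rule mult_left_mono) simp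
  also have "\<dots> = (2 ^ 34 * (B + 1)) * (n * n ^ 4)"
    by (simp add: algebra_simps)
  also have "\<dots> \<le> n * (n * n ^ 4)"
    using assms by (intro mult_right_mono) auto
  also have "\<dots> = (n\<^sup>2) ^ Suc 2"
    by (simp flip: power_mult power_Suc)
  finally show ?thesis
    by (rule power_le_imp_le_base) simp
qed

text \<open>
  Let \<open>X\<close> witness that \<open>y\<close> and \<open>u\<close> are not exchangeable, and let \<open>p \<in> N(y, u) - X\<close>. For a walk
  \<open>y, b, c, u\<close> in the link of \<open>p\<close>, the triple \<open>{p, b, c}\<close> forms a tile with \<open>y\<close>, based on \<open>{p, b}\<close>, and
  with \<open>u\<close>, based on \<open>{p, c}\<close>. Therefore every such walk runs into \<open>X\<close> (or degenerates), and there are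
  few of them: the edge \<open>yu\<close> is sparse in the link of at least \<open>n/8\<close> vertices \<open>p\<close>.
\<close>

lemma sparse_link_of_blocked:
  assumes yu: "y \<in> V" "u \<in> V" "y \<noteq> u" and blocked: "\<not> exchangeable B y u"
    and B: "8 * B \<le> n"
  shows "n \<le> 8 * card {p \<in> V. (y, u) \<in> sparse_link B p}"
proof -
  have "\<exists>X. (finite X \<and> card X \<le> B) \<and>
      \<not> (\<exists>T. T \<inter> X = {} \<and> T \<inter> {y, u} = {} \<and> tile (insert y T) \<and> tile (insert u T))"
    using blocked by (simp only: exchangeable_def not_all not_imp not_ex)
  then obtain X where "(finite X \<and> card X \<le> B) \<and>
      \<not> (\<exists>T. T \<inter> X = {} \<and> T \<inter> {y, u} = {} \<and> tile (insert y T) \<and> tile (insert u T))" ..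
  then have X: "finite X" "card X \<le> B"
    and none: "\<not> (\<exists>T. T \<inter> X = {} \<and> T \<inter> {y, u} = {} \<and> tile (insert y T) \<and> tile (insert u T))"
    by (rule conjunct1[THEN conjunct1], rule conjunct1[THEN conjunct2], rule conjunct2)
  have "(y, u) \<in> sparse_link B p" if p: "p \<in> N y u - X" for p
  proof -
    have "link_walks (link p) y u \<subseteq> insert u X \<times> V \<union> V \<times> insert y X"
    proof (rule subrelI, rule ccontr)
      fix b c assume bc: "(b, c) \<in> link_walks (link p) y u"
        and out: "(b, c) \<notin> insert u X \<times> V \<union> V \<times> insert y X"
      have nb: "b \<in> N p y" "c \<in> N p b" "u \<in> N p c"
        using bc by (auto simp: link_walks_def link_def)
      have avoid: "b \<notin> X" "b \<noteq> u" "c \<notin> X" "c \<noteq> y" using out nbhdD(2,3)[OF nb(2)] by auto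
      have nb': "y \<in> N p b" "b \<in> N p c"
        using nb by (simp_all add: pair_nbhd_def insert_commute)
      have "tile (insert y {p, b, c})"
        by (rule tileI[OF nb'(1) nb(2)]) (use avoid in auto)
      moreover have "tile (insert u {p, b, c})"
        by (rule tileI[OF nb(3) nb'(2)]) (use avoid in auto)
      moreover have "{p, b, c} \<inter> X = {}" using p avoid by auto
      moreover have "{p, b, c} \<inter> {y, u} = {}"
        using avoid p nbhdD(5,6)[of p y u] nbhdD(6)[OF nb(1)] nbhdD(5)[OF nb(1)] nbhdD(6)[OF nb(3)] nbhdD(5)[OF nb(3)]
        by auto
      ultimately show False
        using none by blast
    qed
    then have "card (link_walks (link p) y u) \<le> card (insert u X \<times> V \<union> V \<times> insert y X)"
      using X(1) by (intro card_mono) auto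
    also have "\<dots> \<le> card (insert u X) * n + n * card (insert y X)"
      by (rule order_trans[OF card_Un_le]) (simp add: card_cartesian_product)
    also have "\<dots> \<le> (B + 1) * n + n * (B + 1)"
      using X by (intro add_mono mult_mono) (auto simp: card_insert_if)
    finally show ?thesis
      using p by (simp add: sparse_link_def link_def algebra_simps pair_nbhd_def insert_commute)
  qed
  then have "N y u - X \<subseteq> {p \<in> V. (y, u) \<in> sparse_link B p}"
    using nbhd_subset by blast
  then have "card (N y u - X) \<le> card {p \<in> V. (y, u) \<in> sparse_link B p}"
    by (intro card_mono) auto
  moreover have "card (N y u) - card X \<le> card (N y u - X)"
    using X(1) by (rule diff_card_le_card_Diff)
  ultimately show ?thesis
    using codegree[OF yu] X(2) B by linarith
qed

text \<open>
  Each blocked pair is a sparse edge in at least \<open>n/8\<close> of the \<open>n\<close> links, and each link has at most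
  \<open>n\<^sup>2 / 2\<^sup>1\<^sup>1\<close> sparse edges, so at most \<open>n\<^sup>2 / 256\<close> pairs are blocked. A vertex that is not light lies in
  more than \<open>n/32\<close> of them.
\<close>

lemma most_vertices_light:
  assumes "2 ^ 35 \<le> n" "2 ^ 35 * B \<le> n"
  shows "8 * card {y \<in> V. \<not> light B y} \<le> n"
proof -
  define Bad where "Bad = (SIGMA y:V. blocked B y)"
  have finblocked: "finite (blocked B y)" for y by (simp add: blocked_def)
  have finBad: "finite Bad" using finblocked by (auto simp: Bad_def)
  have finsparse: "finite (sparse_link B p)" for p
    by (rule finite_subset[of _ "V \<times> V"]) (use link_subset[of p] in \<open>auto simp: sparse_link_def\<close>)
  have n0: "0 < n" using assms(1) by (rule less_le_trans[rotated]) simp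
  have "2 ^ 11 * (card Bad * n) = 2 ^ 11 * (\<Sum>e\<in>Bad. n)" by simp
  also have "\<dots> \<le> 2 ^ 11 * (\<Sum>e\<in>Bad. 8 * card {p \<in> V. e \<in> sparse_link B p})"
  proof (intro mult_left_mono sum_mono)
    fix e assume "e \<in> Bad"
    then show "n \<le> 8 * card {p \<in> V. e \<in> sparse_link B p}"
      using sparse_link_of_blocked[of "fst e" "snd e" B] assms(2) by (auto simp: Bad_def blocked_def)
  qed simp
  also have "\<dots> = 8 * (2 ^ 11 * (\<Sum>p\<in>V. card {e \<in> Bad. e \<in> sparse_link B p}))"
    using double_count[OF finBad finite_V, of "\<lambda>e p. e \<in> sparse_link B p"]
    by (simp add: sum_distrib_left[symmetric])
  also have "\<dots> \<le> 8 * (\<Sum>p\<in>V. 2 ^ 11 * card (sparse_link B p))"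
    unfolding sum_distrib_left using finsparse by (intro sum_mono mult_left_mono card_mono) auto
  also have "\<dots> \<le> 8 * (\<Sum>p\<in>V. n\<^sup>2)"
    using assms by (intro mult_left_mono sum_mono card_sparse_link) auto
  finally have "n * (256 * card Bad) \<le> n * n\<^sup>2" by (simp add: algebra_simps)
  then have Bad: "256 * card Bad \<le> n\<^sup>2" using n0 by simp
  define h where "h = card {y \<in> V. \<not> light B y}"
  have "n * (8 * h) = 8 * (\<Sum>y | y \<in> V \<and> \<not> light B y. n)" by (simp add: h_def)
  also have "\<dots> \<le> 8 * (\<Sum>y | y \<in> V \<and> \<not> light B y. 32 * card (blocked B y))"
    by (intro mult_left_mono sum_mono) (auto simp: light_def)
  also have "\<dots> \<le> 8 * (\<Sum>y\<in>V. 32 * card (blocked B y))"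
    by (intro mult_left_mono sum_mono2) auto
  also have "\<dots> = 256 * card Bad"
    using finblocked by (simp add: Bad_def sum_distrib_left[symmetric])
  also have "\<dots> \<le> n * n" using Bad by (simp add: power2_eq_square)
  finally show ?thesis using n0 by (simp add: h_def)
qed

lemma tile_avoiding:
  assumes "finite Y" "4 * card Y + 8 \<le> n"
  obtains T where "tile T" "T \<inter> Y = {}"
proof -
  have "n - card Y \<le> card (V - Y)" using assms(1) by (rule diff_card_le_card_Diff)
  then have "2 \<le> card (V - Y)" using assms(2) by linarith
  then obtain A where "A \<subseteq> V - Y" "card A = 2" by (rule obtain_subset_with_card_n)
  then obtain a b where ab: "a \<in> V - Y" "b \<in> V - Y" "a \<noteq> b" by (auto simp: card_2_iff)
  have "card (N a b) - card Y \<le> card (N a b - Y)" using assms(1) by (rule diff_card_le_card_Diff)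
  then have "2 \<le> card (N a b - Y)" using assms(2) codegree[of a b] ab by auto
  then obtain C where "C \<subseteq> N a b - Y" "card C = 2" by (rule obtain_subset_with_card_n)
  then obtain c d where cd: "c \<in> N a b - Y" "d \<in> N a b - Y" "c \<noteq> d" by (auto simp: card_2_iff)
  then have "tile {a, b, c, d}" by (intro tileI[of c a b d]) auto
  then show ?thesis using that ab cd by auto
qed

text \<open>
  The absorber consists of a tile \<open>U\<close>, whose vertices are matched with those of \<open>Q\<close> by \<open>h\<close>, and
  of a triple \<open>f y\<close> exchanging \<open>y\<close> with \<open>h y\<close> for each \<open>y \<in> Q\<close>. Without \<open>Q\<close> the tiles are the sets
  \<open>f y \<union> {h y}\<close>; with \<open>Q\<close> they are the sets \<open>f y \<union> {y}\<close> and \<open>U\<close>.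
\<close>

lemma absorber_of_light_vertices:
  assumes B: "2 ^ 35 * B \<le> n"
    and Q: "card Q = 4" "\<And>y. y \<in> Q \<Longrightarrow> light B y"
    and X: "finite X" "card X + 20 \<le> B"
  shows "\<exists>A. tileable A \<and> tileable (A \<union> Q) \<and> card A \<le> 16 \<and> A \<inter> (X \<union> Q) = {}"
proof -
  have finQ: "finite Q" using Q(1) card.infinite by fastforce
  define Y where "Y = X \<union> Q \<union> (\<Union>y\<in>Q. blocked B y)"
  have finblocked: "finite (blocked B y)" for y by (simp add: blocked_def)
  have finY: "finite Y" using X finQ finblocked by (simp add: Y_def)
  have "8 * card (\<Union>y\<in>Q. blocked B y) \<le> n"
  proof -
    have "32 * card (\<Union>y\<in>Q. blocked B y) \<le> (\<Sum>y\<in>Q. 32 * card (blocked B y))"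
      using card_UN_le[OF finQ, of "blocked B"] by (simp add: sum_distrib_left[symmetric])
    also have "\<dots> \<le> (\<Sum>y\<in>Q. n)" using Q(2) by (intro sum_mono) (auto simp: light_def)
    finally show ?thesis using Q(1) by simp
  qed
  moreover have "card Y \<le> card X + card Q + card (\<Union>y\<in>Q. blocked B y)"
    unfolding Y_def by (meson card_Un_le add_right_mono order_trans)
  moreover have "8 * B \<le> n" using B by auto
  ultimately have "4 * card Y + 8 \<le> n"
    using Q(1) X(2) by linarith
  then obtain U where U: "tile U" "U \<inter> Y = {}" using tile_avoiding[OF finY] by blast
  note tileU = tileD[OF U(1)]
  obtain h where h: "bij_betw h Q U"
    using finite_same_card_bij[OF finQ tileU(2)] Q(1) tileU(3) by auto
  have hU: "h y \<in> U" if "y \<in> Q" for y using h that by (auto simp: bij_betw_def)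
  have UQ: "U \<inter> Q = {}" using U(2) by (auto simp: Y_def)
  have "\<exists>f. (\<forall>y\<in>Q. (tile (insert y (f y)) \<and> tile (insert (h y) (f y))) \<and> finite (id (f y)) \<and>
        card (id (f y)) \<le> 3 \<and> id (f y) \<inter> (X \<union> Q \<union> U) = {}) \<and>
      (\<forall>y\<in>Q. \<forall>z\<in>Q. y \<noteq> z \<longrightarrow> id (f y) \<inter> id (f z) = {})"
  proof (rule greedy_disjoint_choice[where B = B])
    show "finite Q" "finite (X \<union> Q \<union> U)" using finQ X tileU by auto
    have "card (X \<union> Q \<union> U) \<le> card X + card Q + card U"
      by (meson card_Un_le add_right_mono order_trans)
    then show "card Q * 3 + card (X \<union> Q \<union> U) \<le> B" using X(2) Q(1) tileU(3) by simp
  next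
    fix y and Z :: "'a set" assume y: "y \<in> Q" and Z: "finite Z" "card Z \<le> B"
    have "h y \<in> V" "h y \<noteq> y" "h y \<notin> blocked B y"
      using hU[OF y] y tileU UQ U(2) by (auto simp: Y_def)
    then have "exchangeable B y (h y)" by (simp add: blocked_def)
    then obtain T where T: "T \<inter> Z = {}" "T \<inter> {y, h y} = {}" "tile (insert y T)" "tile (insert (h y) T)"
      using Z unfolding exchangeable_def by metis
    then have "finite T" "card T = 3" using tileD[OF T(3)] by (auto simp: card_insert_if)
    then show "\<exists>T. (tile (insert y T) \<and> tile (insert (h y) T)) \<and> finite (id T) \<and> card (id T) \<le> 3 \<and> id T \<inter> Z = {}"
      using T by auto
  qed
  then obtain f where "(\<forall>y\<in>Q. (tile (insert y (f y)) \<and> tile (insert (h y) (f y))) \<and> finite (id (f y)) \<and>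
        card (id (f y)) \<le> 3 \<and> id (f y) \<inter> (X \<union> Q \<union> U) = {}) \<and>
      (\<forall>y\<in>Q. \<forall>z\<in>Q. y \<noteq> z \<longrightarrow> id (f y) \<inter> id (f z) = {})" ..
  then have f: "\<And>y. y \<in> Q \<Longrightarrow> tile (insert y (f y)) \<and> tile (insert (h y) (f y)) \<and>
      card (f y) \<le> 3 \<and> f y \<inter> (X \<union> Q \<union> U) = {}"
    and disj: "\<And>y z. y \<in> Q \<Longrightarrow> z \<in> Q \<Longrightarrow> y \<noteq> z \<Longrightarrow> f y \<inter> f z = {}"
    by simp_all
  define A where "A = (\<Union>y\<in>Q. insert (h y) (f y))"
  have A: "A = U \<union> (\<Union>y\<in>Q. f y)" using h by (auto simp: A_def bij_betw_def)
  have h_inj: "h y \<noteq> h z" if "y \<in> Q" "z \<in> Q" "y \<noteq> z" for y z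
    using h that by (auto simp: bij_betw_def inj_on_def)
  have "tileable A"
    unfolding A_def
  proof (rule tileable_UN[OF finQ])
    fix y z assume yz: "y \<in> Q" "z \<in> Q" "y \<noteq> z"
    then show "insert (h y) (f y) \<inter> insert (h z) (f z) = {}"
      using f[of y] f[of z] disj[OF yz] h_inj[OF yz] hU[of y] hU[of z] by auto
  qed (use f tileable_tile in blast)
  moreover have "A \<union> Q = U \<union> (\<Union>y\<in>Q. insert y (f y))" using A by auto
  moreover have "tileable (U \<union> (\<Union>y\<in>Q. insert y (f y)))"
  proof (intro tileable_Un tileable_UN[OF finQ] tileable_tile)
    show "U \<inter> (\<Union>y\<in>Q. insert y (f y)) = {}" using UQ f by blast
    fix y z assume yz: "y \<in> Q" "z \<in> Q" "y \<noteq> z"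
    then show "insert y (f y) \<inter> insert z (f z) = {}"
      using f[of y] f[of z] disj[OF yz] by auto
  qed (use f U in blast)+
  moreover have "card A \<le> 16"
  proof -
    have "card (\<Union>y\<in>Q. f y) \<le> (\<Sum>y\<in>Q. card (f y))" by (rule card_UN_le[OF finQ])
    also have "\<dots> \<le> card Q * 3" using sum_bounded_above[of Q "\<lambda>y. card (f y)" 3] f by simp
    finally show ?thesis using card_Un_le[of U "\<Union>y\<in>Q. f y"] tileU(3) Q(1) by (simp add: A)
  qed
  moreover have "A \<inter> (X \<union> Q) = {}" using f U(2) by (auto simp: A Y_def)
  ultimately show ?thesis by metis
qed

section \<open>Slots that admit every vertex\<close>

text \<open>
  A slot is a triple \<open>R\<close> with a current occupant \<open>y\<close>. The first alternative holds for the one vertex of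
  \<open>N(a, b)\<close> that belongs to \<open>R = {a, b, c}\<close>; it lets \<open>R\<close> admit all of \<open>N(a, b)\<close>, and it
  never occurs for a vertex outside the slot.
\<close>

definition admits :: "'a set \<Rightarrow> 'a \<Rightarrow> bool" where
  "admits R x \<longleftrightarrow> x \<in> R \<or> tile (insert x R)"

text \<open>
  Every \<open>x \<in> U\<close> lies in \<open>N(a, b)\<close> for roughly a quarter or more of all ordered pairs, of which
  \<open>X\<close> spoils few. So an average pair outside \<open>X\<close> captures at least a fifth of \<open>U\<close>.
\<close>

lemma high_coverage_pair:
  assumes "2 ^ 35 \<le> n" "2 ^ 35 * B \<le> n" and X: "finite X" "card X \<le> B" and U: "U \<subseteq> V"
  shows "\<exists>a\<in>V - X. \<exists>b\<in>V - X. a \<noteq> b \<and> card U \<le> 10 * card (N a b \<inter> U)"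
proof (rule ccontr)
  assume "\<not> ?thesis"
  then have low: "10 * card (N a b \<inter> U) < card U" if "a \<in> V - X" "b \<in> V - X" "a \<noteq> b" for a b
    using that not_le by blast
  have finU: "finite U" using U finite_V by (rule finite_subset)
  have B: "100 * B + 100 \<le> n" using assms(1,2) by auto
  define P where "P = (V - X) \<times> (V - X)"
  have finP: "finite P" by (simp add: P_def)
  have cardVX: "n - B \<le> card (V - X)"
    using diff_card_le_card_Diff[OF X(1), of V] X(2) by linarith
  have "0 < card U"
  proof -
    have "2 \<le> card (V - X)" using cardVX B by linarith
    then obtain A where "A \<subseteq> V - X" "card A = 2" by (rule obtain_subset_with_card_n)
    then obtain a b where "a \<in> V - X" "b \<in> V - X" "a \<noteq> b" by (auto simp: card_2_iff)
    from low[OF this] show ?thesis by simp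
  qed
  have lower: "real n * real n / 5 \<le> real (card {p \<in> P. x \<in> N (fst p) (snd p)})" if x: "x \<in> U" for x
  proof -
    have xV: "x \<in> V" using x U by blast
    have "{p \<in> P. x \<in> N (fst p) (snd p)} = (SIGMA a:V - X. N x a - X)"
    proof -
      have "x \<in> N a b \<longleftrightarrow> b \<in> N x a" for a b
        by (auto simp: pair_nbhd_def insert_commute)
      then show ?thesis using nbhd_subset[of x] by (auto simp: P_def)
    qed
    then have "real (card {p \<in> P. x \<in> N (fst p) (snd p)}) = (\<Sum>a\<in>V - X. real (card (N x a - X)))"
      by simp
    moreover have "(\<Sum>a\<in>V - X - {x}. real (card (N x a - X))) \<le> (\<Sum>a\<in>V - X. real (card (N x a - X)))"
      by (rule sum_mono2) auto
    moreover have "real (card (V - X - {x})) * (real n / 4 - B) \<le> (\<Sum>a\<in>V - X - {x}. real (card (N x a - X)))"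
    proof (rule sum_bounded_below)
      fix a assume a: "a \<in> V - X - {x}"
      have "card (N x a) - card X \<le> card (N x a - X)" using X(1) by (rule diff_card_le_card_Diff)
      then show "real n / 4 - B \<le> real (card (N x a - X))"
        using codegree[of x a] a xV X(2) by auto
    qed
    moreover have "real n * (99 / 100) * (real n * (24 / 100)) \<le> real (card (V - X - {x})) * (real n / 4 - B)"
    proof (rule mult_mono)
      have "card (V - X) - 1 \<le> card (V - X - {x})"
        using diff_card_le_card_Diff[of "{x}" "V - X"] by simp
      then show "real n * (99 / 100) \<le> real (card (V - X - {x}))"
        using cardVX B by linarith
      show "real n * (24 / 100) \<le> real n / 4 - B"
        using B by linarith
    qed auto
    moreover have "real n * real n / 5 \<le> real n * (99 / 100) * (real n * (24 / 100))"
    proof -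
      have "0 \<le> real n * real n" by simp
      then show ?thesis by simp
    qed
    ultimately show ?thesis by linarith
  qed
  have "2 * (real (card U) * (real n * real n)) = 10 * (real (card U) * (real n * real n / 5))"
    by simp
  also have "\<dots> \<le> 10 * (\<Sum>x\<in>U. real (card {p \<in> P. x \<in> N (fst p) (snd p)}))"
    using sum_bounded_below[of U "real n * real n / 5"] lower by (intro mult_left_mono) auto
  also have "\<dots> = (\<Sum>p\<in>P. real (10 * card {x \<in> U. x \<in> N (fst p) (snd p)}))"
    using double_count[OF finU finP, of "\<lambda>x p. x \<in> N (fst p) (snd p)"]
    by (simp add: sum_distrib_left[symmetric] flip: of_nat_sum)
  also have "\<dots> \<le> (\<Sum>p\<in>P. real (card U))"
  proof (rule sum_mono)
    fix p assume "p \<in> P"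
    then obtain a b where p: "p = (a, b)" "a \<in> V - X" "b \<in> V - X" by (auto simp: P_def)
    have "{x \<in> U. x \<in> N a b} = N a b \<inter> U" by auto
    moreover have "N a b = {}" if "a = b" using nbhdD(4)[of _ a b] that by auto
    ultimately have "10 * card {x \<in> U. x \<in> N a b} \<le> card U"
      using low[of a b] p by (cases "a = b") auto
    then show "real (10 * card {x \<in> U. x \<in> N (fst p) (snd p)}) \<le> real (card U)"
      using p by (simp only: of_nat_le_iff fst_conv snd_conv)
  qed
  also have "\<dots> \<le> real (card U) * (real n * real n)"
  proof -
    have "card (V - X) * card (V - X) \<le> n * n"
      by (intro mult_mono card_mono) auto
    then have "real (card P) \<le> real n * real n"
      by (simp add: P_def card_cartesian_product flip: of_nat_mult)
    then have "real (card U) * real (card P) \<le> real (card U) * (real n * real n)"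
      by (intro mult_left_mono) auto
    then show ?thesis by (simp add: mult.commute)
  qed
  finally have "real (card U) * (real n * real n) \<le> 0" by simp
  moreover have "0 < real (card U) * (real n * real n)"
    using \<open>0 < card U\<close> B by simp
  ultimately show False by linarith
qed

text \<open>
  Of the at least \<open>n/4\<close> neighbours of the base \<open>{a, b}\<close> at most \<open>n/8\<close> are not light, which leaves a choice
  of the occupant \<open>y\<close> and of the third vertex \<open>c\<close> of the slot.
\<close>

lemma swap_slot:
  assumes n: "2 ^ 35 \<le> n" "2 ^ 35 * B \<le> n" and X: "finite X" "card X \<le> B" and U: "U \<subseteq> V"
  shows "\<exists>R y. light B y \<and> y \<notin> R \<and> tile (insert y R) \<and> insert y R \<inter> X = {} \<and>
    card U \<le> 10 * card {x \<in> U. admits R x}"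
proof -
  obtain a b where ab: "a \<in> V - X" "b \<in> V - X" "a \<noteq> b" "card U \<le> 10 * card (N a b \<inter> U)"
    using high_coverage_pair[OF n X U] by blast
  let ?H = "{y \<in> V. \<not> light B y}"
  have "card (N a b) - card (X \<union> ?H) \<le> card (N a b - (X \<union> ?H))"
    using X(1) by (intro diff_card_le_card_Diff) auto
  moreover have "card (X \<union> ?H) \<le> B + card ?H"
    using card_Un_le[of X ?H] X(2) by linarith
  moreover have "real n / 4 \<le> card (N a b)" using codegree[of a b] ab by auto
  moreover have "8 * card ?H \<le> n" using most_vertices_light[OF n] .
  moreover have "16 * B \<le> n" "64 \<le> n" using n by auto
  ultimately have "2 \<le> card (N a b - (X \<union> ?H))" by linarith
  then obtain A where "A \<subseteq> N a b - (X \<union> ?H)" "card A = 2" by (rule obtain_subset_with_card_n)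
  then obtain y c where yc: "y \<in> N a b - (X \<union> ?H)" "c \<in> N a b - (X \<union> ?H)" "y \<noteq> c"
    by (auto simp: card_2_iff)
  have yV: "y \<in> V" using yc(1) nbhd_subset by blast
  have tile_c: "tile (insert x {a, b, c})" if "x \<in> N a b" "x \<noteq> c" for x
    using that yc by (intro tileI[of x a b c]) auto
  have "finite U" using U finite_V by (rule finite_subset)
  then have "card (N a b \<inter> U) \<le> card {x \<in> U. admits {a, b, c} x}"
    using tile_c by (intro card_mono) (auto simp: admits_def)
  then show ?thesis
    using ab yc yV tile_c[of y] nbhdD[of y a b]
    by (intro exI[of _ "{a, b, c}"] exI[of _ y]) auto
qed

definition slot_verts :: "'a set \<times> 'a \<Rightarrow> 'a set" where
  "slot_verts s = insert (snd s) (fst s)"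

definition slot_family :: "nat \<Rightarrow> ('a set \<times> 'a) set \<Rightarrow> bool" where
  "slot_family B F \<longleftrightarrow> finite F \<and>
     (\<forall>s\<in>F. light B (snd s) \<and> snd s \<notin> fst s \<and> tile (slot_verts s)) \<and>
     (\<forall>s\<in>F. \<forall>s'\<in>F. s \<noteq> s' \<longrightarrow> slot_verts s \<inter> slot_verts s' = {})"

lemma slot_family_support:
  assumes "slot_family B F"
  shows "finite (\<Union>(slot_verts ` F))" "card (\<Union>(slot_verts ` F)) \<le> 4 * card F"
proof -
  have "card (slot_verts s) = 4" "finite (slot_verts s)" if "s \<in> F" for s
    using assms that tileD by (auto simp: slot_family_def)
  then show "finite (\<Union>(slot_verts ` F))" "card (\<Union>(slot_verts ` F)) \<le> 4 * card F"
    using card_UN_le[of F slot_verts] assms by (auto simp: slot_family_def mult.commute)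
qed

lemma covering_slot_family:
  assumes n: "2 ^ 35 \<le> n" "2 ^ 35 * B \<le> n"
    and "U \<subseteq> V" "card U * 9 ^ t < 10 ^ t" "finite X" "card X + 4 * t \<le> B"
  shows "\<exists>F. slot_family B F \<and> card F \<le> t \<and> \<Union>(slot_verts ` F) \<inter> X = {} \<and>
    (\<forall>x\<in>U. \<exists>s\<in>F. admits (fst s) x)"
  using assms(3-)
proof (induction t arbitrary: U X)
  case 0
  then have "U = {}" using finite_subset[OF 0(1) finite_V] by simp
  then show ?case by (intro exI[of _ "{}"]) (simp add: slot_family_def)
next
  case (Suc t)
  have "card X \<le> B" using Suc.prems(4) by simp
  then obtain R y where Ry: "light B y" "y \<notin> R" "tile (insert y R)" "insert y R \<inter> X = {}"
    "card U \<le> 10 * card {x \<in> U. admits R x}"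
    using swap_slot[OF n Suc.prems(3) _ Suc.prems(1)] by blast
  define U' where "U' = {x \<in> U. \<not> admits R x}"
  have finU: "finite U" using Suc.prems(1) finite_V by (rule finite_subset)
  have "card U = card {x \<in> U. admits R x} + card U'"
    unfolding U'_def using finU by (subst card_Un_disjoint[symmetric]) (auto intro: arg_cong[where f = card])
  then have "10 * card U' \<le> 9 * card U" using Ry(5) by linarith
  then have "10 * card U' * 9 ^ t \<le> 9 * card U * 9 ^ t" by (rule mult_right_mono) simp
  also have "\<dots> < 10 * 10 ^ t" using Suc.prems(2) by simp
  finally have "card U' * 9 ^ t < 10 ^ t" by simp
  moreover have "U' \<subseteq> V" using Suc.prems(1) by (auto simp: U'_def)
  moreover have "finite (X \<union> insert y R)" using Suc.prems(3) tileD(2)[OF Ry(3)] by simp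
  moreover have "card (X \<union> insert y R) + 4 * t \<le> B"
    using card_Un_le[of X "insert y R"] tileD(3)[OF Ry(3)] Suc.prems(4) by simp
  ultimately obtain F where F: "slot_family B F" "card F \<le> t"
    "\<Union>(slot_verts ` F) \<inter> (X \<union> insert y R) = {}" "\<forall>x\<in>U'. \<exists>s\<in>F. admits (fst s) x"
    using Suc.IH[of U' "X \<union> insert y R"] by blast
  have "slot_family B (insert (R, y) F)"
    using F(1,3) Ry(1-3) unfolding slot_family_def by (auto simp: slot_verts_def)
  moreover have "card (insert (R, y) F) \<le> Suc t"
    using F(1,2) by (simp add: slot_family_def card_insert_if)
  moreover have "\<Union>(slot_verts ` insert (R, y) F) \<inter> X = {}"
    using F(3) Ry(4) by (auto simp: slot_verts_def)
  moreover have "\<forall>x\<in>U. \<exists>s\<in>insert (R, y) F. admits (fst s) x"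
    using F(4) by (auto simp: U'_def)
  ultimately show ?case by blast
qed

section \<open>The absorbing set\<close>

text \<open>
  The absorbing set consists of the vertices \<open>S\<close> of \<open>K\<close> disjoint covering slot families, with \<open>Y\<close> the
  set of their occupants, and of an absorber \<open>A Q\<close> for every quadruple \<open>Q \<subseteq> Y\<close>. Vertices
  \<open>w \<in> W\<close> enter slots \<open>s w\<close> of pairwise different families \<open>i w\<close>, so that no two of them compete for a
  slot. The occupants they expel are light and belong to \<open>Y\<close>; as their number is a multiple of 4, they
  split into quadruples whose absorbers take them in.
\<close>

lemma absorbing_set:
  assumes n: "2 ^ 35 \<le> n" "2 ^ 35 * B \<le> n"
    and t: "n * 9 ^ t < 10 ^ t" and B: "4 * t * (K + 1) + 16 * (K * t) ^ 4 + 20 \<le> B"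
  shows "\<exists>A\<subseteq>V. tileable A \<and> card A \<le> B \<and>
    (\<forall>W\<subseteq>V - A. card W \<le> K \<longrightarrow> 4 dvd card W \<longrightarrow> tileable (A \<union> W))"
proof -
  define supp where "supp F = \<Union>(slot_verts ` F)" for F
  have "\<exists>F. (\<forall>i\<in>{..<K}. (slot_family B (F i) \<and> card (F i) \<le> t \<and> (\<forall>x\<in>V. \<exists>s\<in>F i. admits (fst s) x)) \<and>
        finite (supp (F i)) \<and> card (supp (F i)) \<le> 4 * t \<and> supp (F i) \<inter> {} = {}) \<and>
      (\<forall>i\<in>{..<K}. \<forall>j\<in>{..<K}. i \<noteq> j \<longrightarrow> supp (F i) \<inter> supp (F j) = {})"
  proof (rule greedy_disjoint_choice[where B = "K * (4 * t)"])
    fix X :: "'a set" assume X: "finite X" "card X \<le> K * (4 * t)"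
    have "card X + 4 * t \<le> B" using X(2) B by (simp add: algebra_simps)
    then obtain F where "slot_family B F" "card F \<le> t" "supp F \<inter> X = {}" "\<forall>x\<in>V. \<exists>s\<in>F. admits (fst s) x"
      unfolding supp_def using covering_slot_family[OF n subset_refl t X(1)] by blast
    moreover from this have "finite (supp F)" "card (supp F) \<le> 4 * t"
      using slot_family_support[of B F] by (auto simp: supp_def)
    ultimately show "\<exists>F. (slot_family B F \<and> card F \<le> t \<and> (\<forall>x\<in>V. \<exists>s\<in>F. admits (fst s) x)) \<and>
        finite (supp F) \<and> card (supp F) \<le> 4 * t \<and> supp F \<inter> X = {}"
      by blast
  qed auto
  then obtain F where "(\<forall>i\<in>{..<K}. (slot_family B (F i) \<and> card (F i) \<le> t \<and> (\<forall>x\<in>V. \<exists>s\<in>F i. admits (fst s) x)) \<and>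
        finite (supp (F i)) \<and> card (supp (F i)) \<le> 4 * t \<and> supp (F i) \<inter> {} = {}) \<and>
      (\<forall>i\<in>{..<K}. \<forall>j\<in>{..<K}. i \<noteq> j \<longrightarrow> supp (F i) \<inter> supp (F j) = {})" ..
  then have F: "\<And>i. i < K \<Longrightarrow> slot_family B (F i)" "\<And>i. i < K \<Longrightarrow> card (F i) \<le> t"
    "\<And>i x. i < K \<Longrightarrow> x \<in> V \<Longrightarrow> \<exists>s\<in>F i. admits (fst s) x"
    and supp: "\<And>i. i < K \<Longrightarrow> finite (supp (F i))" "\<And>i. i < K \<Longrightarrow> card (supp (F i)) \<le> 4 * t"
      "\<And>i j. i < K \<Longrightarrow> j < K \<Longrightarrow> i \<noteq> j \<Longrightarrow> supp (F i) \<inter> supp (F j) = {}"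
    by simp_all
  define Sl where "Sl = (\<Union>i<K. F i)"
  define S where "S = supp Sl"
  define Y where "Y = snd ` Sl"
  have finSl: "finite Sl" using F(1) by (auto simp: Sl_def slot_family_def)
  have Sl: "light B (snd s)" "snd s \<notin> fst s" "tile (slot_verts s)" if "s \<in> Sl" for s
    using F(1) that by (auto simp: Sl_def slot_family_def)
  have Sl_disj: "slot_verts s \<inter> slot_verts s' = {}" if ss: "s \<in> Sl" "s' \<in> Sl" "s \<noteq> s'" for s s'
  proof -
    obtain i j where ij: "i < K" "s \<in> F i" "j < K" "s' \<in> F j" using ss by (auto simp: Sl_def)
    show ?thesis
    proof (cases "i = j")
      case True
      then show ?thesis using F(1)[of i] ij ss(3) by (auto simp: slot_family_def)
    next
      case False
      have "slot_verts s \<subseteq> supp (F i)" "slot_verts s' \<subseteq> supp (F j)" using ij by (auto simp: supp_def)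
      then show ?thesis using supp(3)[of i j] ij False by blast
    qed
  qed
  have S_eq: "S = (\<Union>i<K. supp (F i))" by (auto simp: S_def supp_def Sl_def)
  have finS: "finite S" using supp(1) by (simp add: S_eq)
  have cardS: "card S \<le> 4 * t * K"
  proof -
    have "card S \<le> (\<Sum>i<K. card (supp (F i)))" unfolding S_eq by (rule card_UN_le) simp
    also have "\<dots> \<le> (\<Sum>i<K. 4 * t)" using supp(2) by (intro sum_mono) auto
    finally show ?thesis by (simp add: mult.commute)
  qed
  have finY: "finite Y" using finSl by (simp add: Y_def)
  have cardY: "card Y \<le> K * t"
  proof -
    have "card Y \<le> card Sl" unfolding Y_def using finSl by (rule card_image_le)
    also have "\<dots> \<le> (\<Sum>i<K. card (F i))" unfolding Sl_def by (rule card_UN_le) simp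
    also have "\<dots> \<le> (\<Sum>i<K. t)" using F(2) by (intro sum_mono) auto
    finally show ?thesis by simp
  qed
  have YS: "Y \<subseteq> S" by (auto simp: Y_def S_def supp_def slot_verts_def)
  have lightY: "light B y" if "y \<in> Y" for y using Sl(1) that by (auto simp: Y_def)
  have SV: "S \<subseteq> V" using Sl(3) tileD(1) by (auto simp: S_def supp_def)

  define Qs where "Qs = {Q. Q \<subseteq> Y \<and> card Q = 4}"
  have finQs: "finite Qs" using finY by (simp add: Qs_def)
  have cardQs: "card Qs \<le> (K * t) ^ 4"
  proof -
    have "card Qs = card Y choose 4" using n_subsets[OF finY] by (simp add: Qs_def)
    also have "\<dots> \<le> card Y ^ 4" by (cases "4 \<le> card Y") (auto intro: binomial_le_pow simp: binomial_eq_0)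
    also have "\<dots> \<le> (K * t) ^ 4" using cardY by (rule power_mono) simp
    finally show ?thesis .
  qed
  have "\<exists>A. (\<forall>Q\<in>Qs. (tileable (A Q) \<and> tileable (A Q \<union> Q)) \<and> finite (id (A Q)) \<and>
        card (id (A Q)) \<le> 16 \<and> id (A Q) \<inter> S = {}) \<and>
      (\<forall>Q\<in>Qs. \<forall>Q'\<in>Qs. Q \<noteq> Q' \<longrightarrow> id (A Q) \<inter> id (A Q') = {})"
  proof (rule greedy_disjoint_choice[where B = "B - 20"])
    have "card Qs * 16 + card S \<le> (K * t) ^ 4 * 16 + 4 * t * K"
      using cardQs cardS by (intro add_mono mult_right_mono) auto
    then show "card Qs * 16 + card S \<le> B - 20" using B by (simp add: algebra_simps)
  next
    fix Q and X :: "'a set" assume Q: "Q \<in> Qs" and X: "finite X" "card X \<le> B - 20"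
    have "card X + 20 \<le> B" using X(2) B by linarith
    then obtain A where "tileable A" "tileable (A \<union> Q)" "card A \<le> 16" "A \<inter> (X \<union> Q) = {}"
      using absorber_of_light_vertices[OF n(2), of Q X] lightY Q X(1) by (auto simp: Qs_def)
    then show "\<exists>A. (tileable A \<and> tileable (A \<union> Q)) \<and> finite (id A) \<and> card (id A) \<le> 16 \<and> id A \<inter> X = {}"
      using tileable_finite by auto
  qed (use finQs finS in auto)
  then obtain A where "(\<forall>Q\<in>Qs. (tileable (A Q) \<and> tileable (A Q \<union> Q)) \<and> finite (id (A Q)) \<and>
        card (id (A Q)) \<le> 16 \<and> id (A Q) \<inter> S = {}) \<and>
      (\<forall>Q\<in>Qs. \<forall>Q'\<in>Qs. Q \<noteq> Q' \<longrightarrow> id (A Q) \<inter> id (A Q') = {})" ..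
  then have A: "\<And>Q. Q \<in> Qs \<Longrightarrow> tileable (A Q)" "\<And>Q. Q \<in> Qs \<Longrightarrow> tileable (A Q \<union> Q)"
      "\<And>Q. Q \<in> Qs \<Longrightarrow> card (A Q) \<le> 16" "\<And>Q. Q \<in> Qs \<Longrightarrow> A Q \<inter> S = {}"
    and A_disj: "\<And>Q Q'. Q \<in> Qs \<Longrightarrow> Q' \<in> Qs \<Longrightarrow> Q \<noteq> Q' \<Longrightarrow> A Q \<inter> A Q' = {}"
    by simp_all
  define AQ where "AQ = (\<Union>Q\<in>Qs. A Q)"
  have AQS: "AQ \<inter> S = {}" using A(4) by (auto simp: AQ_def)
  have AQV: "AQ \<subseteq> V" using A(1) tileable_subset by (auto simp: AQ_def)

  have absorb: "tileable (S \<union> AQ \<union> W)"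
    if W: "W \<subseteq> V - (S \<union> AQ)" "card W \<le> K" "4 dvd card W" for W
  proof -
    have finW: "finite W" using W(1) by (rule finite_subset) simp
    obtain i where i: "i ` W \<subseteq> {..<K}" "inj_on i W"
      using card_le_inj[of W "{..<K}"] finW W(2) by auto
    have "\<forall>w\<in>W. \<exists>s. s \<in> F (i w) \<and> admits (fst s) w"
      using F(3) i(1) W(1) by (metis Diff_iff image_subset_iff lessThan_iff subsetD)
    then obtain s where s: "\<And>w. w \<in> W \<Longrightarrow> s w \<in> F (i w)" "\<And>w. w \<in> W \<Longrightarrow> admits (fst (s w)) w"
      by metis
    have sSl: "s w \<in> Sl" if "w \<in> W" for w using s(1)[OF that] i(1) that by (auto simp: Sl_def)
    have slot_S: "slot_verts r \<subseteq> S" if "r \<in> Sl" for r using that by (auto simp: S_def supp_def)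
    have tile_s: "tile (insert w (fst (s w)))" if w: "w \<in> W" for w
    proof -
      have "w \<notin> slot_verts (s w)" using slot_S[OF sSl[OF w]] W(1) w by auto
      then show ?thesis using s(2)[OF w] by (auto simp: admits_def slot_verts_def)
    qed
    have s_inj: "s w \<noteq> s w'" if ww: "w \<in> W" "w' \<in> W" "w \<noteq> w'" for w w'
    proof
      assume eq: "s w = s w'"
      have "i w \<noteq> i w'" using i(2) ww by (auto simp: inj_on_def)
      moreover have "i w < K" "i w' < K" using i(1) ww by auto
      moreover have "slot_verts (s w) \<subseteq> supp (F (i w))" "slot_verts (s w) \<subseteq> supp (F (i w'))"
        using s(1)[OF ww(1)] s(1)[OF ww(2)] eq by (auto simp: supp_def)
      ultimately have "slot_verts (s w) = {}" using supp(3)[of "i w" "i w'"] by blast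
      then show False by (simp add: slot_verts_def)
    qed
    define y where "y w = snd (s w)" for w
    define Out where "Out = y ` W"
    have y_slot: "y w \<in> slot_verts (s w)" for w by (simp add: y_def slot_verts_def)
    have "inj_on y W"
    proof (rule inj_onI, rule ccontr)
      fix w w' assume ww: "w \<in> W" "w' \<in> W" "y w = y w'" "w \<noteq> w'"
      then show False
        using Sl_disj[OF sSl sSl s_inj, of w w'] y_slot[of w] y_slot[of w'] by auto
    qed
    then have "card Out = card W" by (simp add: Out_def card_image)
    then obtain Q where Q: "\<Union>Q = Out" "\<forall>q\<in>Q. card q = 4" "pairwise disjnt Q"
      using partition_into_fours[of Out] finW W(3) by (auto simp: Out_def)
    have OutY: "Out \<subseteq> Y" using sSl by (auto simp: Out_def y_def Y_def)
    have QQs: "Q \<subseteq> Qs" using Q OutY by (auto simp: Qs_def)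

    \<comment> \<open>The tile formed by a slot: with its new vertex if there is one, with its occupant otherwise.\<close>
    define piece where "piece r = (if r \<in> s ` W then insert (the_inv_into W s r) (fst r) else slot_verts r)" for r
    have s_inj_on: "inj_on s W" using s_inj by (auto simp: inj_on_def)
    have piece_s: "piece (s w) = insert w (fst (s w))" if "w \<in> W" for w
      using that by (simp add: piece_def the_inv_into_f_f[OF s_inj_on])
    have piece_other: "piece r = slot_verts r" if "r \<notin> s ` W" for r using that by (simp add: piece_def)
    have piece_tile: "tile (piece r)" if "r \<in> Sl" for r
      using that piece_s tile_s piece_other Sl(3) by (cases "r \<in> s ` W") auto
    have piece_sub: "piece r \<subseteq> slot_verts r \<union> W" for r
      using piece_s piece_other[of r] by (cases "r \<in> s ` W") (auto simp: slot_verts_def)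
    have piece_W: "w \<in> piece r \<Longrightarrow> r = s w" if "r \<in> Sl" "w \<in> W" for r w
    proof -
      assume w: "w \<in> piece r"
      have "w \<notin> slot_verts r" using slot_S[OF that(1)] W(1) that(2) by auto
      then obtain w' where w': "w' \<in> W" "r = s w'" using w piece_other by blast
      then have "w = w'" using w piece_s[OF w'(1)] \<open>w \<notin> slot_verts r\<close> by (auto simp: slot_verts_def)
      then show "r = s w" using w' by simp
    qed
    have "tileable (\<Union>r\<in>Sl. piece r)"
    proof (rule tileable_UN[OF finSl])
      show "tileable (piece r)" if "r \<in> Sl" for r using piece_tile[OF that] by (rule tileable_tile)
      fix r r' assume r: "r \<in> Sl" "r' \<in> Sl" "r \<noteq> r'"
      have False if x: "x \<in> piece r" "x \<in> piece r'" for x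
      proof (cases "x \<in> W")
        case True
        then show False using piece_W x r by metis
      next
        case False
        then show False using piece_sub[of r] piece_sub[of r'] x Sl_disj[OF r] by blast
      qed
      then show "piece r \<inter> piece r' = {}" by blast
    qed
    moreover have "(\<Union>r\<in>Sl. piece r) = (S - Out) \<union> W"
    proof (intro equalityI subsetI)
      fix x assume "x \<in> (\<Union>r\<in>Sl. piece r)"
      then obtain r where r: "r \<in> Sl" "x \<in> piece r" by blast
      show "x \<in> (S - Out) \<union> W"
      proof (cases "x \<in> W")
        case False
        then have xr: "x \<in> slot_verts r" using piece_sub[of r] r(2) by blast
        have "x \<notin> Out"
        proof
          assume "x \<in> Out"
          then obtain w where w: "w \<in> W" "x = y w" by (auto simp: Out_def)
          then have "r = s w" using Sl_disj[OF r(1) sSl[OF w(1)]] xr y_slot[of w] by blast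
          then have "x \<in> insert w (fst (s w))" using r(2) piece_s[OF w(1)] by simp
          then show False using False w Sl(2)[OF sSl[OF w(1)]] by (auto simp: y_def)
        qed
        then show ?thesis using slot_S[OF r(1)] xr by blast
      qed simp
    next
      fix x assume "x \<in> (S - Out) \<union> W"
      then show "x \<in> (\<Union>r\<in>Sl. piece r)"
      proof
        assume "x \<in> W"
        then show ?thesis using piece_s sSl by blast
      next
        assume x: "x \<in> S - Out"
        then obtain r where r: "r \<in> Sl" "x \<in> slot_verts r" by (auto simp: S_def supp_def)
        have "x \<in> piece r"
        proof (cases "r \<in> s ` W")
          case True
          then obtain w where w: "w \<in> W" "r = s w" by blast
          then have "x \<noteq> snd r" using x by (auto simp: Out_def y_def)
          then show ?thesis using piece_s[OF w(1)] w(2) r(2) by (auto simp: slot_verts_def)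
        next
          case False
          then show ?thesis using piece_other r by simp
        qed
        then show ?thesis using r(1) by blast
      qed
    qed
    ultimately have t1: "tileable ((S - Out) \<union> W)" by simp

    \<comment> \<open>The absorbers of the quadruples in \<open>Q\<close> are used, all others are tiled by themselves.\<close>
    define part where "part q = (if q \<in> Q then A q \<union> q else A q)" for q
    have "tileable (\<Union>q\<in>Qs. part q)"
    proof (rule tileable_UN[OF finQs])
      show "tileable (part q)" if "q \<in> Qs" for q using A(1,2)[OF that] by (simp add: part_def)
      fix q q' assume q: "q \<in> Qs" "q' \<in> Qs" "q \<noteq> q'"
      have "q \<subseteq> S" "q' \<subseteq> S" using q YS by (auto simp: Qs_def)
      then have "A q \<inter> q' = {}" "q \<inter> A q' = {}" using A(4)[OF q(1)] A(4)[OF q(2)] by blast+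
      moreover have "q \<inter> q' = {}" if "q \<in> Q" "q' \<in> Q"
        using Q(3) that q(3) by (auto simp: pairwise_def disjnt_def)
      ultimately show "part q \<inter> part q' = {}"
        using A_disj[OF q] by (auto simp: part_def)
    qed
    moreover have "(\<Union>q\<in>Qs. part q) = AQ \<union> Out"
      using QQs Q(1) by (auto simp: part_def AQ_def)
    ultimately have t2: "tileable (AQ \<union> Out)" by simp
    have OutS: "Out \<subseteq> S" using OutY YS by blast
    have "((S - Out) \<union> W) \<inter> (AQ \<union> Out) = {}"
      using AQS W(1) OutS by blast
    then have "tileable (((S - Out) \<union> W) \<union> (AQ \<union> Out))" by (rule tileable_Un[OF t1 t2])
    moreover have "((S - Out) \<union> W) \<union> (AQ \<union> Out) = S \<union> AQ \<union> W" using OutS by blast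
    ultimately show ?thesis by simp
  qed
  have "card (S \<union> AQ) \<le> B"
  proof -
    have "card AQ \<le> (\<Sum>Q\<in>Qs. card (A Q))" unfolding AQ_def by (rule card_UN_le[OF finQs])
    also have "\<dots> \<le> card Qs * 16" using sum_bounded_above[of Qs "\<lambda>Q. card (A Q)" 16] A(3) by simp
    also have "\<dots> \<le> (K * t) ^ 4 * 16" using cardQs by simp
    finally have "card AQ \<le> (K * t) ^ 4 * 16" .
    moreover have "card (S \<union> AQ) \<le> card S + card AQ" by (rule card_Un_le)
    ultimately show ?thesis using cardS B by (simp add: algebra_simps)
  qed
  moreover have "tileable (S \<union> AQ)" using absorb[of "{}"] by simp
  ultimately show ?thesis using absorb SV AQV by (intro exI[of _ "S \<union> AQ"]) auto
qed

lemma tileable_if_nonextremal: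
  fixes \<gamma> \<epsilon> :: real and K :: nat
  assumes n: "2 ^ 35 \<le> n" "2 ^ 35 * B \<le> n" "4 dvd n"
    and t: "n * 9 ^ t < 10 ^ t" and B: "4 * t * (K + 1) + 16 * (K * t) ^ 4 + 20 \<le> B"
    and \<gamma>: "0 < \<gamma>" "12 * \<gamma> \<le> \<epsilon>" "1 \<le> \<gamma> * n" "B \<le> \<gamma> * n" and K: "30 / \<gamma> + 1 \<le> K"
    and nonextremal: "\<not> extremal \<epsilon> G"
  shows "tileable V"
proof -
  obtain A where A: "A \<subseteq> V" "tileable A" "card A \<le> B"
    and absorb: "\<And>W. W \<subseteq> V - A \<Longrightarrow> card W \<le> K \<Longrightarrow> 4 dvd card W \<Longrightarrow> tileable (A \<union> W)"
    using absorbing_set[OF n(1,2) t B] by blast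
  have tile_in_large: "\<exists>T\<subseteq>S. tile T" if "S \<subseteq> V" "(1 - \<epsilon>) * (3 * n / 4) \<le> card S" for S
  proof -
    have "\<not> D_free (induced G S)"
      using nonextremal that unfolding extremal_def by auto
    then show ?thesis
      unfolding D_free_def using tile_of_D_copy by metis
  qed
  then obtain S where S: "S \<subseteq> V - A" "tileable S" "card (V - A - S) \<le> K"
  proof -
    have "real (card A) \<le> \<gamma> * n" using A(3) \<gamma>(4) by linarith
    from almost_tiling[OF \<gamma>(1-3) K A(1) this tile_in_large] show ?thesis using that by auto
  qed
  let ?W = "V - A - S"
  have fin: "finite A" "finite S" using A(2) S(2) by (auto intro: tileable_finite)
  have "card ?W = n - card A - card S"
    using A(1) S(1) fin by (simp add: card_Diff_subset)
  then have "4 dvd card ?W"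
    using n(3) tileable_dvd[OF A(2)] tileable_dvd[OF S(2)] by (simp add: dvd_diff_nat)
  then have AW: "tileable (A \<union> ?W)" using S(3) by (intro absorb) auto
  have "(A \<union> ?W) \<inter> S = {}" using S(1) by blast
  then have "tileable ((A \<union> ?W) \<union> S)" by (rule tileable_Un[OF AW S(2)])
  moreover have "(A \<union> ?W) \<union> S = V" using A(1) S(1) by blast
  ultimately show ?thesis by simp
qed

end

section \<open>The non-extremal case\<close>

theorem theorem1p5:
  fixes \<epsilon> :: real
  assumes "\<epsilon> > 0"
  shows "\<exists>n0::nat. \<forall>n\<ge>n0. 4 dvd n \<longrightarrow>
           (\<forall>G :: 'a hypergraph.
              three_graph G \<and> graph_order G = n \<and>
              min_codegree G \<ge> (if odd (n div 4) then n div 4 else n div 4 + 1) \<and>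
              \<not> extremal \<epsilon> G \<longrightarrow>
              D_tileable G)"
proof -
  define \<gamma> where "\<gamma> = \<epsilon> / 12"
  define K where "K = nat \<lceil>30 / \<gamma> + 1\<rceil>"
  \<comment> \<open>The absorbing set must be small both as the set removed in \<open>almost_tiling\<close> and as a set that
    exchangeable vertices can avoid; its size does not affect the number \<open>K\<close> of leftover vertices.\<close>
  define c where "c = min \<gamma> (1 / 2 ^ 35)"
  have \<gamma>: "0 < \<gamma>" "12 * \<gamma> \<le> \<epsilon>" using assms by (auto simp: \<gamma>_def)
  have K: "30 / \<gamma> + 1 \<le> real K" unfolding K_def by linarith
  have "0 < c" using \<gamma> by (simp add: c_def)
  then obtain n1 where n1: "\<And>n. n1 \<le> n \<Longrightarrow> \<exists>t B. n * 9 ^ t < 10 ^ t \<and>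
    4 * t * (K + 1) + 16 * (K * t) ^ 4 + 20 \<le> B \<and> real B \<le> c * real n"
    using logarithmic_parameters[of c K] by blast
  define n0 where "n0 = max n1 (max (2 ^ 35) (nat \<lceil>1 / \<gamma>\<rceil>))"
  show ?thesis
  proof (intro exI[of _ n0] allI impI)
    fix n and G :: "'a hypergraph"
    assume n: "n0 \<le> n" "4 dvd n"
      and G: "three_graph G \<and> graph_order G = n \<and>
        min_codegree G \<ge> (if odd (n div 4) then n div 4 else n div 4 + 1) \<and> \<not> extremal \<epsilon> G"
    have fin: "finite (verts G)" using G by (simp add: three_graph_def)
    interpret codegree_hypergraph G
    proof
      show "three_graph G" using G by simp
      fix u v assume uv: "u \<in> verts G" "v \<in> verts G" "u \<noteq> v"
      let ?D = "{card (pair_nbhd G u v) | u v. u \<in> verts G \<and> v \<in> verts G \<and> u \<noteq> v}"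
      have "finite ?D"
        by (rule finite_subset[of _ "(\<lambda>(u, v). card (pair_nbhd G u v)) ` (verts G \<times> verts G)"])
          (use fin in auto)
      then have "min_codegree G \<le> card (pair_nbhd G u v)"
        unfolding min_codegree_def using uv by (intro Min_le) auto
      moreover have "n div 4 \<le> min_codegree G" using G by (auto split: if_splits)
      ultimately have "n div 4 \<le> card (pair_nbhd G u v)" by linarith
      then show "real (card (verts G)) / 4 \<le> real (card (pair_nbhd G u v))"
        using G n(2) by (auto elim!: dvdE)
    qed
    obtain t B where tB: "n * 9 ^ t < 10 ^ t" "4 * t * (K + 1) + 16 * (K * t) ^ 4 + 20 \<le> B"
      "real B \<le> c * real n"
      using n1[of n] n(1) by (auto simp: n0_def)
    have c: "c \<le> \<gamma>" "c \<le> 1 / 2 ^ 35" unfolding c_def by (rule min.cobounded1 min.cobounded2)+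
    have "real B \<le> \<gamma> * real n"
      using tB(3) mult_right_mono[OF c(1) of_nat_0_le_iff[of n]] by linarith
    moreover have "real B \<le> (1 / 2 ^ 35) * real n"
      using tB(3) mult_right_mono[OF c(2) of_nat_0_le_iff[of n]] by linarith
    then have "real (2 ^ 35 * B) \<le> real n" by simp
    then have "2 ^ 35 * B \<le> n" by (simp only: of_nat_le_iff)
    moreover have "1 / \<gamma> \<le> real n" using n(1) unfolding n0_def by linarith
    then have "1 \<le> \<gamma> * real n" using \<gamma>(1) by (simp add: field_simps)
    moreover have "2 ^ 35 \<le> n" using n(1) unfolding n0_def by (meson max.boundedE)
    ultimately have "tileable (verts G)"
      using tileable_if_nonextremal[of B t K \<gamma> \<epsilon>] tB(1,2) n(2) \<gamma> K G by auto
    then show "D_tileable G" by (rule D_tileable_if_tileable)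
  qed
qed

end
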